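(* Let $\mathbb{F}\in\{\mathbb{R},\mathbb{C},\mathbb{H}\}$ and $m=\dim_{\mathbb{R}}(\mathbb{F})$. Then $\mathcal{C}_{4,\mathbb{F}}$ is a $4m$-dimensional austere submanifold of the unit sphere $S(4,\mathbb{F})$.
   Context: $A^*$ denotes the conjugate transpose. $E(4,\mathbb{F})=\{A\in M(4,\mathbb{F}): A^*=A,\ \operatorname{tr}A=0\}$ is a real vector space with inner product $\langle A,B\rangle=\mathfrak{R}(\operatorname{tr}AB^* )$ ($\mathfrak{R}$ is the real part), and $S(4,\mathbb{F})$ is its unit sphere. $\mathcal{C}_{4,\mathbb{F}}$ is the set of $A\in S(4,\mathbb{F})$ with $\operatorname{tr}A^3=0$ which are critical points of the function $A\mapsto\operatorname{tr}A^3$ on $S(4,\mathbb{F})$. It equals the orbit $U(4,\mathbb{F})\cdot\frac12\operatorname{diag}(1,-1,1,-1)$, where $U(4,\mathbb{F})$ is $\operatorname{SO}(4)$, $\operatorname{U}(4)$, $\operatorname{Sp}(4)$ for $\mathbb{F}=\mathbb{R},\mathbb{C},\mathbb{H}$ respectively, acting by $P\cdot A=P^*AP$. A submanifold of a Riemannian manifold is austere if, for every normal vector $\xi$, all symmetric polynomials of odd degree in the eigenvalues of the shape operator $S_\xi$ vanish; equivalently the principal curvatures with respect to $\xi$, counted with multiplicity, have the form $\lambda_1,-\lambda_1,\dots,\lambda_q,-\lambda_q,0,\dots,0$. *)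

theory Defs
  imports "HOL-Analysis.Analysis"
begin

section \<open>The quaternions\<close>

codatatype quat = Quat (qRe: real) (qI: real) (qJ: real) (qK: real)

lemma quat_eq_iff: "x = y \<longleftrightarrow> qRe x = qRe y \<and> qI x = qI y \<and> qJ x = qJ y \<and> qK x = qK y"
  by (auto intro: quat.expand)

instantiation quat :: ring_1
begin

primcorec zero_quat where
  "qRe 0 = 0" | "qI 0 = 0" | "qJ 0 = 0" | "qK 0 = 0"

primcorec one_quat where
  "qRe 1 = 1" | "qI 1 = 0" | "qJ 1 = 0" | "qK 1 = 0"

primcorec plus_quat where
  "qRe (x + y) = qRe x + qRe y"
| "qI (x + y) = qI x + qI y"
| "qJ (x + y) = qJ x + qJ y"
| "qK (x + y) = qK x + qK y"

primcorec uminus_quat where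
  "qRe (- x) = - qRe x" | "qI (- x) = - qI x" | "qJ (- x) = - qJ x" | "qK (- x) = - qK x"

primcorec minus_quat where
  "qRe (x - y) = qRe x - qRe y"
| "qI (x - y) = qI x - qI y"
| "qJ (x - y) = qJ x - qJ y"
| "qK (x - y) = qK x - qK y"

primcorec times_quat where
  "qRe (x * y) = qRe x * qRe y - qI x * qI y - qJ x * qJ y - qK x * qK y"
| "qI (x * y) = qRe x * qI y + qI x * qRe y + qJ x * qK y - qK x * qJ y"
| "qJ (x * y) = qRe x * qJ y - qI x * qK y + qJ x * qRe y + qK x * qI y"
| "qK (x * y) = qRe x * qK y + qI x * qJ y - qJ x * qI y + qK x * qRe y"

instance
  by standard (simp_all add: quat_eq_iff algebra_simps)

end

instantiation quat :: real_div_algebra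
begin

primcorec scaleR_quat where
  "qRe (scaleR r x) = r * qRe x"
| "qI (scaleR r x) = r * qI x"
| "qJ (scaleR r x) = r * qJ x"
| "qK (scaleR r x) = r * qK x"

primcorec inverse_quat where
  "qRe (inverse x) = qRe x / ((qRe x)\<^sup>2 + (qI x)\<^sup>2 + (qJ x)\<^sup>2 + (qK x)\<^sup>2)"
| "qI (inverse x) = - qI x / ((qRe x)\<^sup>2 + (qI x)\<^sup>2 + (qJ x)\<^sup>2 + (qK x)\<^sup>2)"
| "qJ (inverse x) = - qJ x / ((qRe x)\<^sup>2 + (qI x)\<^sup>2 + (qJ x)\<^sup>2 + (qK x)\<^sup>2)"
| "qK (inverse x) = - qK x / ((qRe x)\<^sup>2 + (qI x)\<^sup>2 + (qJ x)\<^sup>2 + (qK x)\<^sup>2)"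

definition "x div y = x * inverse y" for x y :: quat

instance
proof
  fix x y :: quat and a b :: real
  have nz: "(qRe x)\<^sup>2 + (qI x)\<^sup>2 + (qJ x)\<^sup>2 + (qK x)\<^sup>2 \<noteq> 0" if "x \<noteq> 0"
  proof
    assume "(qRe x)\<^sup>2 + (qI x)\<^sup>2 + (qJ x)\<^sup>2 + (qK x)\<^sup>2 = 0"
    moreover have "0 \<le> (qRe x)\<^sup>2" "0 \<le> (qI x)\<^sup>2" "0 \<le> (qJ x)\<^sup>2" "0 \<le> (qK x)\<^sup>2" by simp_all
    ultimately have "(qRe x)\<^sup>2 = 0" "(qI x)\<^sup>2 = 0" "(qJ x)\<^sup>2 = 0" "(qK x)\<^sup>2 = 0" by linarith+
    then show False using that by (simp add: quat_eq_iff)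
  qed
  show "x \<noteq> 0 \<Longrightarrow> inverse x * x = 1"
    using nz by (simp add: quat_eq_iff add_divide_distrib[symmetric] diff_divide_distrib[symmetric]
        power2_eq_square algebra_simps)
  show "x \<noteq> 0 \<Longrightarrow> x * inverse x = 1"
    using nz by (simp add: quat_eq_iff add_divide_distrib[symmetric] diff_divide_distrib[symmetric]
        power2_eq_square algebra_simps)
  show "x div y = x * inverse y" by (rule divide_quat_def)
  show "inverse (0::quat) = 0" by (simp add: quat_eq_iff)
qed (simp_all add: quat_eq_iff algebra_simps)

end

instantiation quat :: real_inner
begin

definition "inner x y = qRe x * qRe y + qI x * qI y + qJ x * qJ y + qK x * qK y" for x y :: quat

definition "norm x = sqrt ((qRe x)\<^sup>2 + (qI x)\<^sup>2 + (qJ x)\<^sup>2 + (qK x)\<^sup>2)" for x :: quat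

definition sgn_quat_def: "sgn x = x /\<^sub>R norm x" for x :: quat

definition dist_quat_def: "dist x y = norm (x - y)" for x y :: quat

definition uniformity_quat_def [code del]:
  "(uniformity :: (quat \<times> quat) filter) = (INF e\<in>{0 <..}. principal {(x, y). dist x y < e})"

definition open_quat_def [code del]:
  "open (U :: quat set) \<longleftrightarrow> (\<forall>x\<in>U. eventually (\<lambda>(x', y). x' = x \<longrightarrow> y \<in> U) uniformity)"

instance
proof
  fix x y z :: quat and r :: real
  show "inner x y = inner y x" "inner (x + y) z = inner x z + inner y z"
    "inner (scaleR r x) y = r * inner x y" "0 \<le> inner x x"
    unfolding inner_quat_def by (simp_all add: algebra_simps)
  show "inner x x = 0 \<longleftrightarrow> x = 0"
    unfolding inner_quat_def by (simp add: add_nonneg_eq_0_iff quat_eq_iff)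
  show "norm x = sqrt (inner x x)"
    unfolding inner_quat_def norm_quat_def by (simp add: power2_eq_square)
qed (rule sgn_quat_def dist_quat_def open_quat_def uniformity_quat_def)+

end

instance quat :: real_normed_div_algebra
proof
  fix x y :: quat
  show "norm (x * y) = norm x * norm y"
    unfolding norm_quat_def real_sqrt_mult [symmetric]
    by (rule arg_cong[where f = sqrt]) (simp add: power2_eq_square algebra_simps)
qed

instantiation quat :: euclidean_space
begin

definition Basis_quat_def: "Basis = {1, Quat 0 1 0 0, Quat 0 0 1 0, Quat 0 0 0 1}"

instance
proof
  fix u v x :: quat
  show "(Basis :: quat set) \<noteq> {}" "finite (Basis :: quat set)"
    by (simp_all add: Basis_quat_def)
  show "u \<bullet> v = (if u = v then 1 else 0)" if "u \<in> Basis" "v \<in> Basis"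
    using that unfolding Basis_quat_def
    by (elim insertE emptyE; hypsubst; simp add: inner_quat_def quat_eq_iff)
  show "(\<forall>u\<in>Basis. x \<bullet> u = 0) \<longleftrightarrow> x = 0"
    unfolding Basis_quat_def by (simp add: inner_quat_def) (simp add: quat_eq_iff)
qed

end

lemma DIM_quat [simp]: "DIM(quat) = 4"
  by (simp add: Basis_quat_def quat_eq_iff)


section \<open>The common structure of the real, complex and quaternionic numbers\<close>

class conj_algebra = real_normed_div_algebra + euclidean_space +
  fixes conjugate :: "'a \<Rightarrow> 'a" and real_part :: "'a \<Rightarrow> real"
  assumes conjugate_mult: "conjugate (x * y) = conjugate y * conjugate x"
    and add_conjugate: "x + conjugate x = (2 * real_part x) *\<^sub>R 1"
    and inner_eq_real_part: "x \<bullet> y = real_part (x * conjugate y)"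

instantiation real :: conj_algebra
begin
definition "conjugate x = x" for x :: real
definition "real_part x = x" for x :: real
instance
  by standard (simp_all add: conjugate_real_def real_part_real_def)
end

instantiation complex :: conj_algebra
begin
definition "conjugate = cnj"
definition "real_part = Re"
instance
proof
  fix x y :: complex
  show "conjugate (x * y) = conjugate y * conjugate x"
    by (simp add: conjugate_complex_def)
  show "x + conjugate x = (2 * real_part x) *\<^sub>R 1"
    by (simp add: conjugate_complex_def real_part_complex_def complex_eq_iff)
  show "x \<bullet> y = real_part (x * conjugate y)"
    by (simp add: conjugate_complex_def real_part_complex_def inner_complex_def)
qed
end

instantiation quat :: conj_algebra
begin
definition "conjugate x = Quat (qRe x) (- qI x) (- qJ x) (- qK x)" for x :: quat
definition "real_part = qRe"
instance
proof
  fix x y :: quat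
  show "conjugate (x * y) = conjugate y * conjugate x"
    unfolding quat_eq_iff by (simp add: conjugate_quat_def algebra_simps)
  show "x + conjugate x = (2 * real_part x) *\<^sub>R 1"
    unfolding quat_eq_iff by (simp add: conjugate_quat_def real_part_quat_def)
  show "x \<bullet> y = real_part (x * conjugate y)"
    by (simp add: conjugate_quat_def real_part_quat_def inner_quat_def)
qed
end


section \<open>Hermitian matrices\<close>

definition adj :: "'a::conj_algebra^'n^'m \<Rightarrow> 'a^'m^'n" where
  "adj A = (\<chi> i j. conjugate (A $ j $ i))"

definition trace_inner :: "'a::conj_algebra^'n^'n \<Rightarrow> 'a^'n^'n \<Rightarrow> real" where
  "trace_inner A B = real_part (trace (A ** adj B))"

lemma real_part_eq_inner: "real_part x = x \<bullet> 1" for x :: "'a::conj_algebra"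
proof -
  define c where "c = 2 * real_part (1::'a) - 1"
  have c: "conjugate (1::'a) = c *\<^sub>R 1"
    using add_conjugate[of "1::'a"] by (simp add: c_def algebra_simps)
  have "c *\<^sub>R (1::'a) = (c * c) *\<^sub>R 1"
    using conjugate_mult[of 1 "1::'a"] by (simp add: c)
  then have "c = c * c"
    by (metis scaleR_right_imp_eq zero_neq_one)
  then consider "c = 1" | "c = 0" by (metis mult_cancel_left1)
  then have "conjugate (1::'a) = 1"
  proof cases
    case 2
    then have "(1::'a) \<bullet> 1 = real_part (0::'a)"
      using inner_eq_real_part[of 1 "1::'a"] by (simp add: c)
    moreover have "(0::'a) \<bullet> 0 = real_part (0::'a)"
      using inner_eq_real_part[of 0 "0::'a"] by simp
    ultimately show ?thesis by simp
  qed (simp add: c)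
  then show ?thesis using inner_eq_real_part[of x 1] by simp
qed

lemma trace_inner_eq_inner: "trace_inner A B = A \<bullet> B"
proof -
  have *: "(x * conjugate y) \<bullet> 1 = x \<bullet> y" for x y :: 'a
    by (simp only: inner_eq_real_part[of x y] real_part_eq_inner)
  show ?thesis
    by (simp add: trace_inner_def trace_def matrix_matrix_mult_def adj_def real_part_eq_inner
        inner_sum_left inner_vec_def *)
qed

text \<open>Hence the topology, orthogonality and induced Riemannian metrics taken below from the
  library's Euclidean structure on matrices are those of \<^const>\<open>trace_inner\<close>.\<close>

definition herm0 :: "('a::conj_algebra^'n^'n) set" where
  "herm0 = {A. adj A = A \<and> trace A = 0}"

definition herm_sphere :: "('a::conj_algebra^'n^'n) set" where
  "herm_sphere = {A \<in> herm0. trace_inner A A = 1}"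

text \<open>For Hermitian \<open>A\<close> the trace of \<open>A\<^sup>3\<close> is real, also over the quaternions; the real part
  only converts it to type \<^typ>\<open>real\<close>.\<close>

definition cubic_form :: "'a::conj_algebra^'n^'n \<Rightarrow> real" where
  "cubic_form A = real_part (trace (A ** A ** A))"


section \<open>Submanifolds of Euclidean spaces\<close>

text \<open>\<open>C\<^sup>k\<close> and smooth maps on \<open>U\<close>; only meant for open \<open>U\<close>.\<close>

primrec Ck_on :: "nat \<Rightarrow> 'a::euclidean_space set \<Rightarrow> ('a \<Rightarrow> 'b::euclidean_space) \<Rightarrow> bool" where
  "Ck_on 0 U f \<longleftrightarrow> continuous_on U f"
| "Ck_on (Suc k) U f \<longleftrightarrow>
     f differentiable_on U \<and> (\<forall>v. Ck_on k U (\<lambda>x. frechet_derivative f (at x) v))"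

definition smooth_on :: "'a::euclidean_space set \<Rightarrow> ('a \<Rightarrow> 'b::euclidean_space) \<Rightarrow> bool" where
  "smooth_on U f \<longleftrightarrow> (\<forall>k. Ck_on k U f)"

text \<open>Embedded submanifolds, by slice charts.\<close>

definition smooth_submanifold :: "nat \<Rightarrow> 'a::euclidean_space set \<Rightarrow> bool" where
  "smooth_submanifold d M \<longleftrightarrow>
     (\<forall>p\<in>M. \<exists>U V \<phi> \<psi> L. open U \<and> p \<in> U \<and> open V \<and>
        homeomorphism U V \<phi> \<psi> \<and> smooth_on U \<phi> \<and> smooth_on V \<psi> \<and>
        subspace L \<and> dim L = d \<and> \<phi> ` (U \<inter> M) = V \<inter> (L :: 'a set))"

text \<open>For embedded submanifolds \<open>M \<subseteq> N\<close> of a Euclidean space, \<open>M\<close> is automatically an embedded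
  submanifold of \<open>N\<close>.\<close>

definition submanifold_of :: "nat \<Rightarrow> 'a::euclidean_space set \<Rightarrow> 'a set \<Rightarrow> bool" where
  "submanifold_of d M N \<longleftrightarrow> (\<exists>n. smooth_submanifold n N) \<and> smooth_submanifold d M \<and> M \<subseteq> N"

definition curve_through :: "'a::euclidean_space set \<Rightarrow> 'a \<Rightarrow> (real \<Rightarrow> 'a) \<Rightarrow> bool" where
  "curve_through M p \<gamma> \<longleftrightarrow>
     (\<exists>\<epsilon>>0. smooth_on {-\<epsilon><..<\<epsilon>} \<gamma> \<and> \<gamma> ` {-\<epsilon><..<\<epsilon>} \<subseteq> M \<and> \<gamma> 0 = p)"

definition tangent_space :: "'a::euclidean_space set \<Rightarrow> 'a \<Rightarrow> 'a set" where
  "tangent_space M p = {v. \<exists>\<gamma>. curve_through M p \<gamma> \<and> (\<gamma> has_vector_derivative v) (at 0)}"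

definition critical_point_on :: "('a::euclidean_space \<Rightarrow> real) \<Rightarrow> 'a set \<Rightarrow> 'a \<Rightarrow> bool" where
  "critical_point_on f M p \<longleftrightarrow>
     p \<in> M \<and> (\<forall>\<gamma>. curve_through M p \<gamma> \<longrightarrow> ((f \<circ> \<gamma>) has_real_derivative 0) (at 0))"


section \<open>Shape operator and principal curvatures\<close>

definition orth_proj :: "'a::euclidean_space set \<Rightarrow> 'a \<Rightarrow> 'a" where
  "orth_proj T v = (THE w. w \<in> T \<and> (\<forall>u\<in>T. (v - w) \<bullet> u = 0))"

text \<open>The normal space of \<open>M\<close> inside the Riemannian manifold \<open>N\<close>.\<close>

definition normal_space :: "'a::euclidean_space set \<Rightarrow> 'a set \<Rightarrow> 'a \<Rightarrow> 'a set" where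
  "normal_space N M p = {\<xi> \<in> tangent_space N p. \<forall>X\<in>tangent_space M p. \<xi> \<bullet> X = 0}"

text \<open>The Levi-Civita connection of the metric induced on \<open>N\<close> by the Euclidean space is the
  tangential part of the Euclidean derivative.  Vector fields along submanifolds are represented
  by smooth extensions to open subsets of the Euclidean space.\<close>

definition levi_civita ::
    "'a::euclidean_space set \<Rightarrow> ('a \<Rightarrow> 'a) \<Rightarrow> 'a \<Rightarrow> 'a \<Rightarrow> 'a" where
  "levi_civita N \<nu> p X = orth_proj (tangent_space N p) (frechet_derivative \<nu> (at p) X)"

definition normal_extension ::
    "'a::euclidean_space set \<Rightarrow> 'a set \<Rightarrow> 'a \<Rightarrow> 'a \<Rightarrow> ('a \<Rightarrow> 'a) \<Rightarrow> bool" where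
  "normal_extension N M p \<xi> \<nu> \<longleftrightarrow>
     (\<exists>U. open U \<and> p \<in> U \<and> smooth_on U \<nu> \<and> (\<forall>q\<in>U \<inter> M. \<nu> q \<in> normal_space N M q)) \<and> \<nu> p = \<xi>"

text \<open>The shape operator \<open>X \<mapsto> - (\<nabla>\<^sub>X \<nu>)\<^sup>\<top>\<close>; the value does not depend on the extension
  \<open>\<nu>\<close> of the normal vector \<open>\<xi>\<close>.\<close>

definition shape_operator ::
    "'a::euclidean_space set \<Rightarrow> 'a set \<Rightarrow> 'a \<Rightarrow> 'a \<Rightarrow> 'a \<Rightarrow> 'a" where
  "shape_operator N M p \<xi> X =
     (THE Y. \<exists>\<nu>. normal_extension N M p \<xi> \<nu> \<and> Y = - orth_proj (tangent_space M p) (levi_civita N \<nu> p X))"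

text \<open>The eigenvalues of the shape operator, each repeated according to its multiplicity.
  The operator is self-adjoint, so the multiplicity is the dimension of the eigenspace.\<close>

definition principal_curvatures ::
    "'a::euclidean_space set \<Rightarrow> 'a set \<Rightarrow> 'a \<Rightarrow> 'a \<Rightarrow> real list \<Rightarrow> bool" where
  "principal_curvatures N M p \<xi> \<kappa>s \<longleftrightarrow>
     length \<kappa>s = dim (tangent_space M p) \<and>
     (\<forall>\<mu>. count_list \<kappa>s \<mu> = dim {X \<in> tangent_space M p. shape_operator N M p \<xi> X = \<mu> *\<^sub>R X})"


section \<open>Austere submanifolds\<close>

text \<open>A homogeneous polynomial of degree \<open>k\<close> in \<open>n\<close> variables is given by its coefficients
  \<open>c \<alpha>\<close> for \<open>\<alpha> \<in> exponents n k\<close>.\<close>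

definition exponents :: "nat \<Rightarrow> nat \<Rightarrow> (nat \<Rightarrow> nat) set" where
  "exponents n k = {\<alpha>. (\<forall>i\<ge>n. \<alpha> i = 0) \<and> (\<Sum>i<n. \<alpha> i) = k}"

lemma finite_exponents: "finite (exponents n k)"
proof (rule finite_subset)
  show "exponents n k \<subseteq> {\<alpha>. \<forall>i. (i \<in> {..<n} \<longrightarrow> \<alpha> i \<in> {..k}) \<and> (i \<notin> {..<n} \<longrightarrow> \<alpha> i = 0)}"
    by (auto simp: exponents_def intro: member_le_sum[of _ "{..<n}"])
  show "finite {\<alpha>. \<forall>i. (i \<in> {..<n} \<longrightarrow> \<alpha> i \<in> {..k}) \<and> (i \<notin> {..<n} \<longrightarrow> \<alpha> i = (0::nat))}"
    by (rule finite_set_of_finite_funs) auto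
qed

definition symmetric_coeffs :: "nat \<Rightarrow> nat \<Rightarrow> ((nat \<Rightarrow> nat) \<Rightarrow> real) \<Rightarrow> bool" where
  "symmetric_coeffs n k c \<longleftrightarrow>
     (\<forall>\<pi> \<alpha>. \<pi> permutes {..<n} \<longrightarrow> \<alpha> \<in> exponents n k \<longrightarrow> c (\<alpha> \<circ> \<pi>) = c \<alpha>)"

definition eval_homogeneous :: "nat \<Rightarrow> nat \<Rightarrow> ((nat \<Rightarrow> nat) \<Rightarrow> real) \<Rightarrow> (nat \<Rightarrow> real) \<Rightarrow> real" where
  "eval_homogeneous n k c x = (\<Sum>\<alpha>\<in>exponents n k. c \<alpha> * (\<Prod>i<n. x i ^ \<alpha> i))"

definition odd_symmetric_vanish :: "real list \<Rightarrow> bool" where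
  "odd_symmetric_vanish \<kappa>s \<longleftrightarrow>
     (\<forall>k c. odd k \<longrightarrow> symmetric_coeffs (length \<kappa>s) k c \<longrightarrow>
        eval_homogeneous (length \<kappa>s) k c ((!) \<kappa>s) = 0)"

definition austere_submanifold :: "nat \<Rightarrow> 'a::euclidean_space set \<Rightarrow> 'a set \<Rightarrow> bool" where
  "austere_submanifold d M N \<longleftrightarrow>
     submanifold_of d M N \<and>
     (\<forall>p\<in>M. \<forall>\<xi>\<in>normal_space N M p.
        \<exists>\<kappa>s. principal_curvatures N M p \<xi> \<kappa>s \<and> odd_symmetric_vanish \<kappa>s)"


section \<open>The critical set\<close>

definition crit_set :: "('a::conj_algebra^4^4) set" where
  "crit_set = {A \<in> herm_sphere. trace (A ** A ** A) = 0 \<and> critical_point_on cubic_form herm_sphere A}"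

end

theory Submission
  imports Defs
begin

text \<open>The three cases are treated at once, over an arbitrary type of class \<open>conj_algebra\<close>.

  The gradient of \<open>tr A\<^sup>3\<close> on Hermitian matrices is \<open>3 A\<^sup>2\<close>. At a critical point on the sphere of trace-free
  Hermitian matrices, \<open>A\<^sup>2\<close> is therefore a combination of \<open>A\<close> and the identity, and \<open>tr A\<^sup>3 = 0\<close> leaves only
  \<open>A\<^sup>2 = 1/4\<close> (\<open>crit_set_eq_involutions\<close>): the critical set consists of the halved reflections in the
  two-dimensional subspaces of \<open>F\<^sup>4\<close>, a Grassmannian.

  Near a point \<open>A\<^sub>0\<close>, the map \<open>A \<mapsto> (A + A\<^sub>0)\<^sup>-\<^sup>1 / 2 - A\<^sub>0\<close> is an involution of an open set of matrices.  It carries the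
  critical set to the linear space of the Hermitian matrices that anticommute with \<open>A\<^sub>0\<close>
  (\<open>matrix_inversion_mem_anticommutant_iff\<close>). This is the matrix form of the inversion that carries a sphere to a
  hyperplane. It yields slice charts whose smoothness only needs that of matrix inversion, and it
  identifies the tangent space at \<open>A\<close> with the anticommutant of \<open>A\<close>. In the block
  decomposition given by the two eigenspaces of \<open>A\<close>, the anticommutant consists of the off-diagonal
  Hermitian matrices, so its dimension is that of the \<open>2 \<times> 2\<close> matrices over \<open>F\<close>.

  Normal vectors \<open>\<xi>\<close> are the trace-free Hermitian matrices that commute with \<open>A\<close> and are orthogonal to
  it. Differentiating the relation \<open>\<nu> A = A \<nu>\<close> for a normal field \<open>\<nu>\<close> yields the shape operator
  \<open>X \<mapsto> - 2 (A \<xi> X + X A \<xi>)\<close> (\<open>shape_operator_involutions\<close>). Both diagonal \<open>2 \<times> 2\<close> blocks of \<open>\<xi>\<close> are trace-free, and such a block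
  anticommutes with some Hermitian involution. Hence there is a Hermitian involution \<open>G\<close> that commutes with \<open>A\<close> and
  anticommutes with \<open>\<xi>\<close> (\<open>anticommuting_involution\<close>). Conjugation with \<open>G\<close> preserves the tangent space
  and turns the shape operator into its negative, so the eigenvalues \<open>\<mu>\<close> and \<open>-\<mu>\<close> have equal
  multiplicities, which makes the symmetric polynomials of odd degree vanish.\<close>


section \<open>Conjugation\<close>

text \<open>The class axioms leave no choice for the conjugation: it is the reflection that fixes the real line.  Its linearity, its
  involutivity and its compatibility with the inner product follow from this formula.\<close>

lemma conjugate_eq: "conjugate x = (2 * (x \<bullet> 1)) *\<^sub>R 1 - (x::'a::conj_algebra)"
  using add_conjugate[of x] by (simp add: real_part_eq_inner algebra_simps)

lemma linear_conjugate: "linear (conjugate :: 'a::conj_algebra \<Rightarrow> 'a)"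
  by (rule linearI) (simp_all add: conjugate_eq inner_add_left algebra_simps)

lemma inner_one_one [simp]: "(1::'a::conj_algebra) \<bullet> 1 = 1"
  by (simp add: dot_square_norm)

lemma conjugate_conjugate [simp]: "conjugate (conjugate x) = (x::'a::conj_algebra)"
  by (simp add: conjugate_eq inner_diff_left)

lemma conjugate_one [simp]: "conjugate (1::'a::conj_algebra) = 1"
  unfolding conjugate_eq[of 1] by (simp add: scaleR_2)

lemma conjugate_zero [simp]: "conjugate (0::'a::conj_algebra) = 0"
  using linear_0[OF linear_conjugate] .

lemmas conjugate_add = linear_add[OF linear_conjugate]
  and conjugate_minus = linear_neg[OF linear_conjugate]
  and conjugate_scaleR = linear_scale[OF linear_conjugate]
  and conjugate_sum = linear_sum[OF linear_conjugate]

lemma inner_mult_one: "(x * y) \<bullet> 1 = x \<bullet> conjugate (y::'a::conj_algebra)"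
  using inner_eq_real_part[of x "conjugate y"] by (simp add: real_part_eq_inner)

lemma inner_conjugate: "conjugate x \<bullet> conjugate y = x \<bullet> (y::'a::conj_algebra)"
  by (simp add: conjugate_eq inner_diff_left inner_diff_right inner_commute)

lemma inner_mult_left_adjoint: "(x * y) \<bullet> z = y \<bullet> (conjugate x * (z::'a::conj_algebra))"
proof -
  have "(x * y) \<bullet> z = ((x * y) * conjugate z) \<bullet> 1"
    by (simp add: inner_mult_one)
  also have "\<dots> = x \<bullet> conjugate (y * conjugate z)"
    by (simp only: mult.assoc inner_mult_one)
  also have "\<dots> = conjugate x \<bullet> (y * conjugate z)"
    using inner_conjugate[of "conjugate x"] by simp
  also have "\<dots> = (y * conjugate z) \<bullet> conjugate x"
    by (rule inner_commute)
  also have "\<dots> = (y * (conjugate z * x)) \<bullet> 1"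
    by (simp add: inner_mult_one mult.assoc[symmetric])
  also have "\<dots> = y \<bullet> (conjugate x * z)"
    by (simp add: inner_mult_one conjugate_mult)
  finally show ?thesis .
qed

lemma self_conjugate_real:
  assumes "conjugate x = x"
  shows "x = (x \<bullet> 1) *\<^sub>R (1::'a::conj_algebra)"
proof -
  from assms have "2 *\<^sub>R x = 2 *\<^sub>R ((x \<bullet> 1) *\<^sub>R 1)"
    unfolding conjugate_eq by (simp add: scaleR_2 algebra_simps)
  then show ?thesis
    by (metis scaleR_left_imp_eq zero_neq_numeral)
qed

lemma conjugate_mult_self: "conjugate x * x = (x \<bullet> x) *\<^sub>R (1::'a::conj_algebra)"
proof -
  have "(conjugate x * x) \<bullet> 1 = x \<bullet> x"
    by (simp add: inner_mult_one inner_conjugate)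
  then show ?thesis
    using self_conjugate_real[of "conjugate x * x"] by (simp add: conjugate_mult)
qed

lemma mult_conjugate_self: "x * conjugate x = (x \<bullet> x) *\<^sub>R (1::'a::conj_algebra)"
  using conjugate_mult_self[of "conjugate x"] by (simp add: inner_conjugate)


section \<open>Matrices over the three algebras\<close>

lemma bilinear_matrix_mult:
  "bilinear ((**) :: 'a::real_algebra_1^'n^'m \<Rightarrow> 'a^'p^'n \<Rightarrow> 'a^'p^'m)"
  unfolding bilinear_def
  by (intro conjI allI linearI)
    (simp_all add: vec_eq_iff matrix_matrix_mult_def sum.distrib distrib_left distrib_right
      scaleR_sum_right)

lemma bounded_bilinear_matrix_mult:
  "bounded_bilinear ((**) :: 'a::{real_algebra_1,euclidean_space}^'n^'m \<Rightarrow> 'a^'p^'n \<Rightarrow> 'a^'p^'m)"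
  using bilinear_matrix_mult bilinear_conv_bounded_bilinear by blast

lemmas matrix_mult_add_left = bilinear_ladd[OF bilinear_matrix_mult]
  and matrix_mult_add_right = bilinear_radd[OF bilinear_matrix_mult]
  and matrix_mult_diff_left = bilinear_lsub[OF bilinear_matrix_mult]
  and matrix_mult_diff_right = bilinear_rsub[OF bilinear_matrix_mult]
  and matrix_mult_minus_left = bilinear_lneg[OF bilinear_matrix_mult]
  and matrix_mult_minus_right = bilinear_rneg[OF bilinear_matrix_mult]
  and matrix_mult_scaleR_left = bilinear_lmul[OF bilinear_matrix_mult]
  and matrix_mult_scaleR_right = bilinear_rmul[OF bilinear_matrix_mult]
  and matrix_mult_zero_left = bilinear_lzero[OF bilinear_matrix_mult]
  and matrix_mult_zero_right = bilinear_rzero[OF bilinear_matrix_mult]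

lemmas matrix_algebra = matrix_mult_add_left matrix_mult_add_right matrix_mult_diff_left
  matrix_mult_diff_right matrix_mult_minus_left matrix_mult_minus_right
  matrix_mult_scaleR_left matrix_mult_scaleR_right matrix_mult_zero_left matrix_mult_zero_right
  matrix_mul_assoc[symmetric]

lemma linear_adj: "linear (adj :: 'a::conj_algebra^'n^'m \<Rightarrow> 'a^'m^'n)"
  by (rule linearI) (simp_all add: adj_def vec_eq_iff conjugate_add conjugate_scaleR)

lemmas adj_linear = linear_add[OF linear_adj] linear_diff[OF linear_adj] linear_neg[OF linear_adj]
  linear_scale[OF linear_adj] linear_0[OF linear_adj]

lemma adj_adj [simp]: "adj (adj A) = A"
  by (simp add: adj_def vec_eq_iff)

lemma adj_mult: "adj (A ** B) = adj B ** adj A"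
  by (simp add: adj_def vec_eq_iff matrix_matrix_mult_def conjugate_sum conjugate_mult)

lemma adj_mat_one [simp]: "adj (mat 1 :: 'a::conj_algebra^'n^'n) = mat 1"
  by (simp add: adj_def vec_eq_iff mat_def)

lemma linear_trace: "linear (trace :: 'a::real_algebra_1^'n^'n \<Rightarrow> 'a)"
  by (rule linearI) (simp_all add: trace_def sum.distrib scaleR_sum_right)

lemmas trace_linear = linear_add[OF linear_trace] linear_diff[OF linear_trace]
  linear_scale[OF linear_trace] linear_0[OF linear_trace]

lemma matrix_inner_left_adjoint:
  fixes A :: "'a::conj_algebra^'n^'m" and B :: "'a^'p^'n"
  shows "(A ** B) \<bullet> C = B \<bullet> (adj A ** C)"
proof -
  have "(A ** B) \<bullet> C = (\<Sum>i\<in>UNIV. \<Sum>j\<in>UNIV. \<Sum>k\<in>UNIV. (A $ i $ k * B $ k $ j) \<bullet> (C $ i $ j))"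
    by (simp add: inner_vec_def matrix_matrix_mult_def inner_sum_left)
  also have "\<dots> = (\<Sum>i\<in>UNIV. \<Sum>j\<in>UNIV. \<Sum>k\<in>UNIV. B $ k $ j \<bullet> (conjugate (A $ i $ k) * C $ i $ j))"
    by (simp add: inner_mult_left_adjoint)
  also have "\<dots> = (\<Sum>i\<in>UNIV. \<Sum>k\<in>UNIV. \<Sum>j\<in>UNIV. B $ k $ j \<bullet> (conjugate (A $ i $ k) * C $ i $ j))"
    by (rule sum.cong[OF refl], rule sum.swap)
  also have "\<dots> = (\<Sum>k\<in>UNIV. \<Sum>i\<in>UNIV. \<Sum>j\<in>UNIV. B $ k $ j \<bullet> (conjugate (A $ i $ k) * C $ i $ j))"
    by (rule sum.swap)
  also have "\<dots> = (\<Sum>k\<in>UNIV. \<Sum>j\<in>UNIV. \<Sum>i\<in>UNIV. B $ k $ j \<bullet> (conjugate (A $ i $ k) * C $ i $ j))"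
    by (rule sum.cong[OF refl], rule sum.swap)
  also have "\<dots> = B \<bullet> (adj A ** C)"
    by (simp add: inner_vec_def matrix_matrix_mult_def inner_sum_right adj_def)
  finally show ?thesis .
qed

lemma inner_adj: "adj A \<bullet> adj B = A \<bullet> B"
  unfolding inner_vec_def adj_def by (simp add: inner_conjugate) (rule sum.swap)

lemma matrix_inner_right_adjoint:
  fixes A :: "'a::conj_algebra^'n^'m" and B :: "'a^'p^'n"
  shows "(A ** B) \<bullet> C = A \<bullet> (C ** adj B)"
proof -
  have "(A ** B) \<bullet> C = (adj B ** adj A) \<bullet> adj C"
    by (simp add: inner_adj flip: adj_mult)
  also have "\<dots> = adj A \<bullet> adj (C ** adj B)"
    by (simp add: matrix_inner_left_adjoint adj_mult)
  finally show ?thesis by (simp add: inner_adj)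
qed

lemma trace_inner_one: "trace A \<bullet> 1 = A \<bullet> mat 1"
proof -
  have "A $ i \<bullet> mat 1 $ i = A $ i $ i \<bullet> 1" for i
  proof -
    have "A $ i \<bullet> mat 1 $ i = (\<Sum>j\<in>UNIV. if j = i then A $ i $ i \<bullet> 1 else 0)"
      unfolding inner_vec_def by (rule sum.cong) (auto simp: mat_def)
    then show ?thesis by simp
  qed
  then show ?thesis
    by (simp add: trace_def inner_sum_left inner_vec_def[of A])
qed

text \<open>The diagonal of a Hermitian matrix is real, so that over the quaternions, too, its trace
  is determined by its real part, which is what the inner product sees.\<close>

lemma hermitian_trace_real:
  assumes "adj A = (A::'a::conj_algebra^'n^'n)"
  shows "trace A = (A \<bullet> mat 1) *\<^sub>R 1"
proof -
  have "conjugate (trace A) = trace A"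
    unfolding trace_def conjugate_sum
    by (rule sum.cong) (use assms in \<open>auto simp: adj_def vec_eq_iff\<close>)
  then show ?thesis
    using self_conjugate_real[of "trace A"] by (simp add: trace_inner_one)
qed

lemma mem_herm0_iff: "A \<in> herm0 \<longleftrightarrow> adj A = A \<and> A \<bullet> mat 1 = 0"
  using hermitian_trace_real[of A] by (auto simp: herm0_def trace_inner_one[symmetric])

lemma subspace_herm0: "subspace (herm0 :: ('a::conj_algebra^'n^'n) set)"
  unfolding subspace_def
  by (auto simp: mem_herm0_iff adj_linear inner_add_left)

lemma herm_sphere_eq: "herm_sphere = {A \<in> herm0. norm A = 1}"
  by (auto simp: herm_sphere_def trace_inner_eq_inner norm_eq_1)

lemma inner_mat_one: "(mat 1 :: 'a::conj_algebra^'n^'n) \<bullet> mat 1 = real CARD('n)"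
proof -
  have "trace (mat 1 :: 'a^'n^'n) \<bullet> 1 = real CARD('n)"
    by (simp add: trace_def inner_sum_left mat_def del: sum_constant) simp
  then show ?thesis by (simp add: trace_inner_one)
qed

lemma cubic_form_eq: "cubic_form A = (A ** A ** A) \<bullet> mat 1"
  by (simp add: cubic_form_def real_part_eq_inner trace_inner_one)


section \<open>Calculus of smooth maps\<close>

lemma Ck_on_Suc_imp_Ck_on: "Ck_on (Suc k) U f \<Longrightarrow> Ck_on k U f"
proof (induction k arbitrary: f)
  case 0
  then show ?case by (simp add: differentiable_imp_continuous_on)
next
  case (Suc k)
  then show ?case by (metis Ck_on.simps(2))
qed

lemma frechet_derivative_cong_open:
  assumes "open U" "x \<in> U" "\<And>y. y \<in> U \<Longrightarrow> f y = g y"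
  shows "frechet_derivative f (at x) = frechet_derivative g (at x)"
proof -
  have "(f has_derivative F) (at x) \<longleftrightarrow> (g has_derivative F) (at x)" for F
    using assms has_derivative_transform_within_open[of f F x UNIV U g]
      has_derivative_transform_within_open[of g F x UNIV U f] by metis
  then show ?thesis by (simp add: frechet_derivative_def)
qed

lemma Ck_on_cong:
  assumes "open U" "\<And>y. y \<in> U \<Longrightarrow> f y = g y"
  shows "Ck_on k U f \<longleftrightarrow> Ck_on k U g"
proof -
  have *: "Ck_on k U g" if "Ck_on k U f" "\<And>y. y \<in> U \<Longrightarrow> f y = g y" for f g :: "'a \<Rightarrow> 'b"
    using that
  proof (induction k arbitrary: f g)
    case 0
    then show ?case using continuous_on_cong[of U U f g] by simp
  next
    case (Suc k)
    have "g differentiable_on U"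
      using Suc.prems differentiable_transform_within[of f _ U 1 g] by (auto simp: differentiable_on_def)
    moreover have "Ck_on k U (\<lambda>x. frechet_derivative g (at x) v)" for v
      by (rule Suc.IH[of "\<lambda>x. frechet_derivative f (at x) v"])
        (use Suc.prems frechet_derivative_cong_open[OF assms(1), of _ f g] in auto)
    ultimately show ?case by simp
  qed
  show ?thesis using assms * by metis
qed

text \<open>The derivatives below are given in closed form on \<open>U\<close> only, in terms of maps that are already known
  to be of class \<open>C\<^sup>k\<close>.\<close>

lemma Ck_on_SucI:
  assumes "open U" "\<And>x. x \<in> U \<Longrightarrow> (f has_derivative F x) (at x)"
    and "\<And>v. Ck_on k U (\<lambda>x. F x v)"
  shows "Ck_on (Suc k) U f"
proof -
  have "f differentiable_on U"
    using assms(2) by (auto simp: differentiable_on_def differentiable_def intro: has_derivative_at_withinI)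
  moreover have "frechet_derivative f (at x) v = F x v" if "x \<in> U" for x v
    using frechet_derivative_at[OF assms(2)[OF that]] by simp
  then have "Ck_on k U (\<lambda>x. frechet_derivative f (at x) v)" for v
    by (subst Ck_on_cong[OF assms(1), of _ "\<lambda>x. F x v"]) (simp_all add: assms(3))
  ultimately show ?thesis by simp
qed

lemma Ck_on_SucD:
  assumes "Ck_on (Suc k) U f" "open U" "x \<in> U"
  shows "(f has_derivative frechet_derivative f (at x)) (at x)"
  using assms by (metis Ck_on.simps(2) at_within_open differentiable_on_def frechet_derivative_works)

lemma Ck_on_const: "Ck_on k U (\<lambda>x. c)"
  by (induction k arbitrary: c) (auto simp: frechet_derivative_const)

lemma Ck_on_bounded_linear: "bounded_linear f \<Longrightarrow> Ck_on k U f"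
proof (cases k)
  case (Suc j)
  assume f: "bounded_linear f"
  have "frechet_derivative f (at x) = f" for x
    using frechet_derivative_at[OF bounded_linear_imp_has_derivative[OF f], of x] by simp
  then show ?thesis using Suc bounded_linear_imp_differentiable_on[OF f] by (simp add: Ck_on_const)
qed (simp add: linear_continuous_on)

lemma Ck_on_add:
  assumes "open U" "Ck_on k U f" "Ck_on k U g"
  shows "Ck_on k U (\<lambda>x. f x + g x)"
  using assms(2,3)
proof (induction k arbitrary: f g)
  case 0
  then show ?case by (simp add: continuous_on_add)
next
  case (Suc k)
  show ?case
  proof (rule Ck_on_SucI[OF assms(1)])
    fix x assume "x \<in> U"
    then show "((\<lambda>x. f x + g x) has_derivative
        (\<lambda>v. frechet_derivative f (at x) v + frechet_derivative g (at x) v)) (at x)"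
      by (intro has_derivative_add Ck_on_SucD[OF Suc.prems(1) assms(1)] Ck_on_SucD[OF Suc.prems(2) assms(1)])
  qed (use Suc in simp)
qed

text \<open>Together with sums, bilinear maps cover every product in use: of scalars, of scalars with vectors, inner products, and products
  of matrices.\<close>

lemma Ck_on_bilinear:
  assumes "bounded_bilinear h" "open U" "Ck_on k U f" "Ck_on k U g"
  shows "Ck_on k U (\<lambda>x. h (f x) (g x))"
  using assms(3,4)
proof (induction k arbitrary: f g)
  case 0
  then show ?case using bounded_bilinear.continuous_on[OF assms(1)] by simp
next
  case (Suc k)
  show ?case
  proof (rule Ck_on_SucI[OF assms(2)])
    fix x assume "x \<in> U"
    then show "((\<lambda>x. h (f x) (g x)) has_derivative
        (\<lambda>v. h (f x) (frechet_derivative g (at x) v) + h (frechet_derivative f (at x) v) (g x))) (at x)"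
      by (intro bounded_bilinear.FDERIV[OF assms(1)] Ck_on_SucD[OF Suc.prems(1) assms(2)]
          Ck_on_SucD[OF Suc.prems(2) assms(2)])
  next
    fix v
    show "Ck_on k U (\<lambda>x. h (f x) (frechet_derivative g (at x) v)
        + h (frechet_derivative f (at x) v) (g x))"
      by (intro Ck_on_add[OF assms(2)] Suc.IH Ck_on_Suc_imp_Ck_on[OF Suc.prems(1)]
          Ck_on_Suc_imp_Ck_on[OF Suc.prems(2)])
        (use Suc.prems in simp_all)
  qed
qed

lemma smooth_on_const: "smooth_on U (\<lambda>x. c)"
  by (simp add: smooth_on_def Ck_on_const)

lemma smooth_on_bounded_linear: "bounded_linear f \<Longrightarrow> smooth_on U f"
  by (simp add: smooth_on_def Ck_on_bounded_linear)

lemma smooth_on_id: "smooth_on U (\<lambda>x. x)"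
  by (rule smooth_on_bounded_linear) (rule bounded_linear_ident)

lemma smooth_on_add: "open U \<Longrightarrow> smooth_on U f \<Longrightarrow> smooth_on U g \<Longrightarrow> smooth_on U (\<lambda>x. f x + g x)"
  by (simp add: smooth_on_def Ck_on_add)

lemma smooth_on_bilinear:
  "bounded_bilinear h \<Longrightarrow> open U \<Longrightarrow> smooth_on U f \<Longrightarrow> smooth_on U g \<Longrightarrow> smooth_on U (\<lambda>x. h (f x) (g x))"
  by (simp add: smooth_on_def Ck_on_bilinear)

lemma smooth_on_scaleR:
  "open U \<Longrightarrow> smooth_on U f \<Longrightarrow> smooth_on U (\<lambda>x. c *\<^sub>R f x)"
  by (rule smooth_on_bilinear[OF bounded_bilinear_scaleR _ smooth_on_const])

lemma smooth_on_diff: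
  assumes "open U" "smooth_on U f" "smooth_on U g"
  shows "smooth_on U (\<lambda>x. f x - g x)"
  using smooth_on_add[OF assms(1,2) smooth_on_scaleR[OF assms(1,3), of "-1"]] by simp

lemma smooth_on_has_derivative:
  "smooth_on U f \<Longrightarrow> open U \<Longrightarrow> x \<in> U \<Longrightarrow> (f has_derivative frechet_derivative f (at x)) (at x)"
  using Ck_on_SucD[of 0 U f x] unfolding smooth_on_def by blast

text \<open>The charts are inversions after translations, and the curves are images of straight lines under the
  charts, so the inner maps of the compositions that occur are affine.\<close>

lemma Ck_on_compose_affine:
  assumes "open U" "bounded_linear L" "Ck_on k U f" "open V" "\<And>x. x \<in> V \<Longrightarrow> c + L x \<in> U"
  shows "Ck_on k V (\<lambda>x. f (c + L x))"
  using assms(3)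
proof (induction k arbitrary: f)
  case 0
  have "continuous_on V (\<lambda>x. c + L x)"
    using assms(2) by (intro continuous_intros linear_continuous_on)
  then show ?case
    using 0 assms(5) continuous_on_compose2[of U f V "\<lambda>x. c + L x"] by auto
next
  case (Suc k)
  show ?case
  proof (rule Ck_on_SucI[OF assms(4)])
    fix x assume x: "x \<in> V"
    have "((\<lambda>x. c + L x) has_derivative L) (at x)"
      using has_derivative_add[OF has_derivative_const bounded_linear_imp_has_derivative[OF assms(2)]]
      by simp
    from has_derivative_compose[OF this Ck_on_SucD[OF Suc.prems assms(1) assms(5)[OF x]]]
    show "((\<lambda>x. f (c + L x)) has_derivative (\<lambda>v. frechet_derivative f (at (c + L x)) (L v))) (at x)"
      by simp
  next
    fix v
    show "Ck_on k V (\<lambda>x. frechet_derivative f (at (c + L x)) (L v))"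
      using Suc.prems by (intro Suc.IH[of "\<lambda>y. frechet_derivative f (at y) (L v)"]) simp
  qed
qed

lemma smooth_on_compose_affine:
  assumes "open U" "bounded_linear L" "smooth_on U f" "open V" "\<And>x. x \<in> V \<Longrightarrow> c + L x \<in> U"
  shows "smooth_on V (\<lambda>x. f (c + L x))"
  using assms Ck_on_compose_affine unfolding smooth_on_def by blast

text \<open>The derivative of the function is a polynomial in the function itself and in \<open>x\<close>, so being of class \<open>C\<^sup>k\<close>
  implies being of class \<open>C\<^sup>k\<^sup>+\<^sup>1\<close>. Matrix inversion is treated in the same way below.\<close>

lemma smooth_on_inverse_norm_squared:
  fixes p :: "'a::euclidean_space"
  shows "smooth_on (- {- p}) (\<lambda>x. inverse ((x + p) \<bullet> (x + p)))"
proof -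
  let ?U = "- {- p}" and ?f = "\<lambda>x. inverse ((x + p) \<bullet> (x + p))"
  have U: "open ?U" by (simp add: open_Compl)
  have pos: "(x + p) \<bullet> (x + p) \<noteq> 0" if "x \<in> ?U" for x
    using that by (auto simp: eq_neg_iff_add_eq_0)
  have "Ck_on k ?U ?f" for k
  proof (induction k)
    case 0
    show ?case using pos by (auto intro!: continuous_intros)
  next
    case (Suc k)
    show ?case
    proof (rule Ck_on_SucI[OF U])
      fix x assume "x \<in> ?U"
      then show "(?f has_derivative (\<lambda>v. (?f x * ?f x) * ((x + p) \<bullet> ((-2) *\<^sub>R v)))) (at x)"
        using pos[of x]
        by (auto intro!: derivative_eq_intros simp: inner_commute algebra_simps)
    next
      fix v
      have "Ck_on k ?U (\<lambda>x. x + p)"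
        by (intro Ck_on_add[OF U] Ck_on_const Ck_on_bounded_linear bounded_linear_ident)
      then show "Ck_on k ?U (\<lambda>x. (?f x * ?f x) * ((x + p) \<bullet> ((-2) *\<^sub>R v)))"
        by (intro Ck_on_bilinear[OF bounded_bilinear_mult U] Ck_on_bilinear[OF bounded_bilinear_inner U]
            Suc.IH Ck_on_const)
    qed
  qed
  then show ?thesis by (simp add: smooth_on_def)
qed


section \<open>Inversion of matrices\<close>

definition invertible_set :: "('a::conj_algebra^'n^'n) set" where
  "invertible_set = {A. invertible A}"

lemma matrix_inv_both:
  assumes "invertible A"
  shows "A ** matrix_inv A = mat 1" "matrix_inv A ** A = mat 1"
  using someI_ex[OF assms[unfolded invertible_def]] by (auto simp: matrix_inv_def)

lemma matrix_inv_unique: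
  assumes "A ** B = mat 1" "B ** A = mat 1"
  shows "matrix_inv A = B" "invertible A"
proof -
  show A: "invertible A" using assms invertible_def by blast
  have "matrix_inv A = matrix_inv A ** (A ** B)" using assms by simp
  also have "\<dots> = B" using matrix_inv_both[OF A] by (simp add: matrix_mul_assoc)
  finally show "matrix_inv A = B" .
qed

text \<open>Left multiplication by \<open>A\<close> is a real-linear endomorphism of the space of matrices, hence surjective if it is injective. The
  argument takes the role of determinants and also holds over the quaternions.\<close>

lemma invertible_if_cancel:
  fixes A :: "'a::conj_algebra^'n^'n"
  assumes "\<And>X :: 'a^'n^'n. A ** X = 0 \<Longrightarrow> X = 0"
  shows "invertible A"
proof -
  let ?L = "\<lambda>X :: 'a^'n^'n. A ** X"
  have lin: "linear ?L"
    by (rule linearI) (simp_all add: matrix_algebra)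
  have "inj ?L"
    using assms linear_injective_0[OF lin] by blast
  then have "surj ?L"
    using linear_injective_imp_surjective[OF lin] by simp
  then obtain B where B: "A ** B = mat 1" by (metis surj_def)
  have "A ** (B ** A - mat 1) = 0"
    using B by (simp add: matrix_mult_diff_right matrix_mul_assoc)
  then have "B ** A = mat 1" using assms by fastforce
  with B show ?thesis using invertible_def by blast
qed

text \<open>An invertible \<open>A\<close> satisfies \<open>|A X| \<ge> c |X|\<close> for all matrices \<open>X\<close>. Nearby matrices inherit the bound
  with \<open>c / 2\<close>, which makes them invertible and bounds their inverses.\<close>

lemma invertible_neighbourhood:
  fixes A :: "'a::conj_algebra^'n^'n"
  assumes "invertible A"
  obtains e K where "e > 0" "\<And>B. norm (B - A) < e \<Longrightarrow> invertible B \<and> norm (matrix_inv B) \<le> K"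
proof -
  obtain C where C: "C > 0" "\<And>(X :: 'a^'n^'n) (Y :: 'a^'n^'n). norm (X ** Y) \<le> norm X * norm Y * C"
    using bounded_bilinear.pos_bounded[OF bounded_bilinear_matrix_mult] by metis
  let ?R = "matrix_inv A"
  define c where "c = inverse ((norm ?R + 1) * C)"
  have "c > 0" using C(1) by (simp add: c_def add_nonneg_pos)
  have low: "c * norm X \<le> norm (A ** X)" for X :: "'a^'n^'n"
  proof -
    have "norm X = norm (?R ** (A ** X))"
      using matrix_inv_both[OF assms] by (simp add: matrix_mul_assoc)
    also have "\<dots> \<le> norm ?R * norm (A ** X) * C" by (rule C)
    also have "\<dots> \<le> (norm ?R + 1) * norm (A ** X) * C"
      using C(1) by (intro mult_right_mono) auto
    finally have "norm X \<le> ((norm ?R + 1) * C) * norm (A ** X)"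
      by (simp add: mult_ac)
    then have "c * norm X \<le> c * (((norm ?R + 1) * C) * norm (A ** X))"
      using \<open>c > 0\<close> by simp
    also have "\<dots> = (c * ((norm ?R + 1) * C)) * norm (A ** X)"
      by (simp only: mult.assoc)
    also have "c * ((norm ?R + 1) * C) = 1"
      unfolding c_def using C(1) by (intro left_inverse) (simp add: add_nonneg_eq_0_iff)
    finally show ?thesis by simp
  qed
  define e where "e = c / (2 * C)"
  have "e > 0" using \<open>c > 0\<close> C by (simp add: e_def)
  moreover have "invertible B \<and> norm (matrix_inv B) \<le> 2 * norm (mat 1 :: 'a^'n^'n) / c"
    if B: "norm (B - A) < e" for B
  proof -
    have half: "c / 2 * norm X \<le> norm (B ** X)" for X :: "'a^'n^'n"
    proof -
      have "norm ((B - A) ** X) \<le> norm (B - A) * norm X * C" by (rule C)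
      also have "\<dots> \<le> e * norm X * C"
        using B C(1) by (intro mult_right_mono) auto
      also have "\<dots> = c / 2 * norm X" using C(1) by (simp add: e_def)
      finally have "norm ((B - A) ** X) \<le> c / 2 * norm X" .
      moreover have "norm (A ** X) \<le> norm (B ** X) + norm ((B - A) ** X)"
        using norm_triangle_ineq4[of "B ** X" "(B - A) ** X"] by (simp add: matrix_mult_diff_left)
      ultimately show ?thesis using low[of X] by simp
    qed
    have inv: "invertible B"
    proof (rule invertible_if_cancel)
      fix X :: "'a^'n^'n" assume "B ** X = 0"
      then show "X = 0" using half[of X] \<open>c > 0\<close> by (simp add: mult_le_0_iff)
    qed
    with half[of "matrix_inv B"] \<open>c > 0\<close> show ?thesis
      by (simp add: matrix_inv_both field_simps)
  qed
  ultimately show thesis using that by blast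
qed

lemma open_invertible_set: "open (invertible_set :: ('a::conj_algebra^'n^'n) set)"
  unfolding open_dist invertible_set_def dist_norm
  using invertible_neighbourhood by (metis mem_Collect_eq)

lemma matrix_inv_diff:
  fixes A B :: "'a::conj_algebra^'n^'n"
  assumes "invertible A" "invertible B"
  shows "matrix_inv B - matrix_inv A = - (matrix_inv B ** (B - A) ** matrix_inv A)"
proof -
  have "matrix_inv B ** (B - A) ** matrix_inv A
      = (matrix_inv B ** B) ** matrix_inv A - matrix_inv B ** (A ** matrix_inv A)"
    by (simp add: matrix_mult_diff_left matrix_mult_diff_right matrix_mul_assoc)
  then show ?thesis by (simp add: matrix_inv_both assms)
qed

lemma has_derivative_matrix_inv:
  fixes A :: "'a::conj_algebra^'n^'n"
  assumes "invertible A"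
  shows "(matrix_inv has_derivative (\<lambda>H. - (matrix_inv A ** H ** matrix_inv A))) (at A)"
proof -
  obtain e K where e: "e > 0" and
    near: "\<And>B. norm (B - A) < e \<Longrightarrow> invertible B \<and> norm (matrix_inv B) \<le> K"
    using invertible_neighbourhood[OF assms] by metis
  obtain C where C: "C > 0" "\<And>(X :: 'a^'n^'n) (Y :: 'a^'n^'n). norm (X ** Y) \<le> norm X * norm Y * C"
    using bounded_bilinear.pos_bounded[OF bounded_bilinear_matrix_mult] by metis
  have C': "norm (X ** Y) \<le> a * b * C" if "norm X \<le> a" "norm Y \<le> b" for X Y :: "'a^'n^'n" and a b
  proof -
    have "0 \<le> a" using that(1) norm_ge_zero order_trans by blast
    then have "norm X * norm Y * C \<le> a * b * C"
      using that C(1) by (intro mult_right_mono mult_mono) auto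
    with C(2)[of X Y] show ?thesis by linarith
  qed
  define M where "M = K * (norm (matrix_inv A) * norm (matrix_inv A) * C) * C * C * C"
  \<comment> \<open>By the resolvent identity, the remainder of the linear approximation contains \<open>B - A\<close> twice.\<close>
  have bound: "norm (matrix_inv B - matrix_inv A + matrix_inv A ** (B - A) ** matrix_inv A)
      \<le> M * (norm (B - A) * norm (B - A))" if "norm (B - A) < e" for B
  proof -
    have B: "invertible B" "norm (matrix_inv B) \<le> K" using near that by auto
    let ?H = "B - A" and ?R = "matrix_inv A" and ?S = "matrix_inv B"
    have "?S - ?R + ?R ** ?H ** ?R = (?R - ?S) ** (?H ** ?R)"
      by (simp only: matrix_mul_assoc matrix_inv_diff[OF assms B(1)])
        (simp add: matrix_mult_diff_left[of ?R ?S] matrix_mult_diff_left[of "?R ** ?H"])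
    also have "\<dots> = (?S ** (?H ** ?R)) ** (?H ** ?R)"
      by (subst minus_diff_eq[symmetric], subst matrix_inv_diff[OF assms B(1)])
         (simp only: matrix_mul_assoc minus_minus)
    finally have eq: "?S - ?R + ?R ** ?H ** ?R = (?S ** (?H ** ?R)) ** (?H ** ?R)" .
    have HR: "norm (?H ** ?R) \<le> norm ?H * norm ?R * C" by (rule C)
    have "norm ((?S ** (?H ** ?R)) ** (?H ** ?R))
        \<le> (K * (norm ?H * norm ?R * C) * C) * (norm ?H * norm ?R * C) * C"
      by (intro C' B HR)
    then show ?thesis unfolding eq M_def by (simp add: algebra_simps)
  qed
  have "\<exists>d>0. \<forall>B. norm (B - A) < d \<longrightarrow>
      norm (matrix_inv B - matrix_inv A - - (matrix_inv A ** (B - A) ** matrix_inv A)) \<le> \<epsilon> * norm (B - A)"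
    if "\<epsilon> > 0" for \<epsilon>
  proof (intro exI conjI allI impI)
    show "min e (\<epsilon> / (\<bar>M\<bar> + 1)) > 0" using e that by (simp add: add_nonneg_pos)
    fix B assume B: "norm (B - A) < min e (\<epsilon> / (\<bar>M\<bar> + 1))"
    then have "(\<bar>M\<bar> + 1) * norm (B - A) \<le> \<epsilon>"
      by (simp add: field_simps add_nonneg_pos)
    moreover have "M * norm (B - A) \<le> (\<bar>M\<bar> + 1) * norm (B - A)"
      by (intro mult_right_mono) auto
    ultimately have "M * norm (B - A) \<le> \<epsilon>" by linarith
    then have "M * norm (B - A) * norm (B - A) \<le> \<epsilon> * norm (B - A)"
      by (intro mult_right_mono) auto
    with bound[of B] B show "norm (matrix_inv B - matrix_inv A
        - - (matrix_inv A ** (B - A) ** matrix_inv A)) \<le> \<epsilon> * norm (B - A)"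
      by (simp add: mult.assoc)
  qed
  moreover have "bounded_linear (\<lambda>H. - (matrix_inv A ** H ** matrix_inv A))"
    by (rule linear_conv_bounded_linear[THEN iffD1, OF linearI]) (simp_all add: matrix_mult_add_left matrix_mult_add_right
        matrix_mult_scaleR_left matrix_mult_scaleR_right)
  ultimately show ?thesis unfolding has_derivative_at_alt by blast
qed

lemma smooth_on_matrix_inv:
  "smooth_on invertible_set (matrix_inv :: 'a::conj_algebra^'n^'n \<Rightarrow> 'a^'n^'n)"
proof -
  let ?U = "invertible_set :: ('a^'n^'n) set"
  have "Ck_on k ?U matrix_inv" for k
  proof (induction k)
    case 0
    have "matrix_inv differentiable_on ?U"
      unfolding differentiable_on_def invertible_set_def
      by (auto intro!: differentiable_at_withinI differentiableI[OF has_derivative_matrix_inv])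
    then show ?case by (simp add: differentiable_imp_continuous_on)
  next
    case (Suc k)
    show ?case
    proof (rule Ck_on_SucI[OF open_invertible_set])
      fix A :: "'a^'n^'n" assume "A \<in> ?U"
      then have "(matrix_inv has_derivative (\<lambda>H. - (matrix_inv A ** H ** matrix_inv A))) (at A)"
        using has_derivative_matrix_inv by (auto simp: invertible_set_def)
      then show "(matrix_inv has_derivative (\<lambda>H. (matrix_inv A ** (- H)) ** matrix_inv A)) (at A)"
        by (simp only: matrix_mult_minus_left matrix_mult_minus_right)
    next
      fix H :: "'a^'n^'n"
      show "Ck_on k ?U (\<lambda>A. (matrix_inv A ** (- H)) ** matrix_inv A)"
        by (rule Ck_on_bilinear[OF bounded_bilinear_matrix_mult open_invertible_set
              Ck_on_bilinear[OF bounded_bilinear_matrix_mult open_invertible_set Suc.IH Ck_on_const] Suc.IH])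
    qed
  qed
  then show ?thesis by (simp add: smooth_on_def)
qed


section \<open>Submanifolds given by an involutive chart\<close>

lemma involution_homeomorphism:
  assumes "\<And>x. x \<in> U \<Longrightarrow> f x \<in> U" "\<And>x. x \<in> U \<Longrightarrow> f (f x) = x" "continuous_on U f"
  shows "homeomorphism U U f f"
  unfolding homeomorphism_def using assms by (auto simp: image_iff) (metis assms(1,2))

text \<open>Both the unit sphere and the critical set are carried to linear subspaces by inversions
  \<open>f\<close> of the ambient space, so the same map serves as chart and as its inverse.\<close>

lemma smooth_submanifold_involutive:
  fixes M :: "'a::euclidean_space set"
  assumes "\<And>p. p \<in> M \<Longrightarrow> \<exists>U f L. open U \<and> p \<in> U \<and> smooth_on U f \<and>
      (\<forall>x\<in>U. f x \<in> U \<and> f (f x) = x \<and> (x \<in> M \<longleftrightarrow> f x \<in> L)) \<and> subspace L \<and> dim L = d"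
  shows "smooth_submanifold d M"
  unfolding smooth_submanifold_def
proof
  fix p assume "p \<in> M"
  obtain U f L where *: "open U \<and> p \<in> U \<and> smooth_on U f \<and>
      (\<forall>x\<in>U. f x \<in> U \<and> f (f x) = x \<and> (x \<in> M \<longleftrightarrow> f x \<in> L)) \<and> subspace L \<and> dim L = d"
    using assms[OF \<open>p \<in> M\<close>] by (elim exE)
  then have U: "open U" "p \<in> U" "smooth_on U f" and L: "subspace L" "dim L = d"
    and f: "\<And>x. x \<in> U \<Longrightarrow> f x \<in> U" "\<And>x. x \<in> U \<Longrightarrow> f (f x) = x"
      "\<And>x. x \<in> U \<Longrightarrow> x \<in> M \<longleftrightarrow> f x \<in> L"
    by blast+
  have "Ck_on 0 U f" using U(3) unfolding smooth_on_def by blast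
  then have "continuous_on U f" by simp
  then have "homeomorphism U U f f" by (intro involution_homeomorphism f)
  moreover have "f ` (U \<inter> M) = U \<inter> L"
  proof (intro equalityI subsetI)
    fix y assume "y \<in> U \<inter> L"
    then show "y \<in> f ` (U \<inter> M)"
      using f[of y] f(3)[of "f y"] by (intro image_eqI[of _ _ "f y"]) auto
  qed (use f in auto)
  ultimately have chart: "open U \<and> p \<in> U \<and> open U \<and> homeomorphism U U f f \<and> smooth_on U f \<and>
      smooth_on U f \<and> subspace L \<and> dim L = d \<and> f ` (U \<inter> M) = U \<inter> L"
    using U L by simp
  show "\<exists>U V \<phi> \<psi> L. open U \<and> p \<in> U \<and> open V \<and> homeomorphism U V \<phi> \<psi> \<and>
      smooth_on U \<phi> \<and> smooth_on V \<psi> \<and> subspace L \<and> dim L = d \<and> \<phi> ` (U \<inter> M) = V \<inter> (L :: 'a set)"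
    by (rule exI[of _ U], rule exI[of _ U], rule exI[of _ f], rule exI[of _ f], rule exI[of _ L], fact chart)
qed

lemma tangent_spaceE:
  assumes "v \<in> tangent_space M p"
  obtains \<gamma> where "\<gamma> 0 = p" "curve_through M p \<gamma>" "(\<gamma> has_vector_derivative v) (at 0)"
    "eventually (\<lambda>t. \<gamma> t \<in> M) (nhds 0)"
proof -
  obtain \<gamma> where \<gamma>: "curve_through M p \<gamma>" "(\<gamma> has_vector_derivative v) (at 0)"
    using assms unfolding tangent_space_def by blast
  then obtain \<epsilon> where e: "\<epsilon> > 0" "\<gamma> ` {-\<epsilon><..<\<epsilon>} \<subseteq> M" "\<gamma> 0 = p"
    unfolding curve_through_def by auto
  have "eventually (\<lambda>t. t \<in> {-\<epsilon><..<\<epsilon>}) (nhds 0)"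
    using e(1) by (intro eventually_nhds_in_open) auto
  then have "eventually (\<lambda>t. \<gamma> t \<in> M) (nhds 0)"
    by eventually_elim (use e in auto)
  with \<gamma> e that show thesis by metis
qed

text \<open>This turns equations that hold on \<open>M\<close> into linear equations for tangent vectors, by differentiation along a curve. The equation may be
  local, since normal fields are only normal near \<open>p\<close>.\<close>

lemma tangent_derivative_zero:
  assumes v: "v \<in> tangent_space M p" and F: "(F has_derivative F') (at p)"
    and U: "open U" "p \<in> U" and const: "\<And>q. q \<in> U \<inter> M \<Longrightarrow> F q = c"
  shows "F' v = 0"
proof -
  obtain \<gamma> where \<gamma>: "\<gamma> 0 = p" "(\<gamma> has_vector_derivative v) (at 0)"
    "eventually (\<lambda>t. \<gamma> t \<in> M) (nhds 0)"
    using v by (rule tangent_spaceE)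
  have "isCont \<gamma> 0" using \<gamma>(2) has_vector_derivative_continuous by blast
  then have "(\<gamma> \<longlongrightarrow> p) (nhds 0)"
    using \<gamma>(1) by (simp add: continuous_at tendsto_nhds_iff)
  then have "eventually (\<lambda>t. \<gamma> t \<in> U) (nhds 0)"
    using U topological_tendstoD by blast
  with \<gamma>(3) have ev: "eventually (\<lambda>t. F (\<gamma> t) = c) (nhds 0)"
    by eventually_elim (use const in auto)
  have "((\<lambda>t. F (\<gamma> t)) has_derivative (\<lambda>t. F' (t *\<^sub>R v))) (at 0)"
    using has_derivative_compose[OF \<gamma>(2)[unfolded has_vector_derivative_def]] F \<gamma>(1) by auto
  moreover have "((\<lambda>t. F (\<gamma> t)) has_derivative (\<lambda>t. 0)) (at 0)"
    using has_derivative_transform_eventually[of "\<lambda>t. c" "\<lambda>t. 0" 0 UNIV "\<lambda>t. F (\<gamma> t)"] ev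
    by (auto simp: eventually_nhds_conv_at eq_commute elim: eventually_mono)
  ultimately have "(\<lambda>t. F' (t *\<^sub>R v)) = (\<lambda>t. 0)"
    by (rule has_derivative_unique)
  then show ?thesis by (metis scaleR_one)
qed

text \<open>Tangent vectors are realised by the images of straight lines through the origin of the chart.\<close>

lemma tangent_space_if_chart:
  assumes U: "open U" "0 \<in> U" and f: "smooth_on U f" "f 0 = p" "(f has_derivative D) (at 0)"
    and L: "subspace L" "\<And>x. x \<in> U \<inter> L \<Longrightarrow> f x \<in> M" and v: "v \<in> L"
  shows "D v \<in> tangent_space M p"
proof -
  let ?V = "(\<lambda>t::real. t *\<^sub>R v) -` U"
  have V: "open ?V" by (intro open_vimage U continuous_intros)
  then obtain e where e: "e > 0" "ball 0 e \<subseteq> ?V"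
    using U(2) by (metis openE scaleR_zero_left vimageI)
  have ball: "ball 0 e = {-e<..<e}" by (auto simp: dist_real_def)
  have "smooth_on {-e<..<e} (\<lambda>t. f (0 + t *\<^sub>R v))"
  proof (rule smooth_on_compose_affine[OF U(1) bounded_linear_scaleR_left f(1)])
    show "0 + t *\<^sub>R v \<in> U" if "t \<in> {-e<..<e}" for t
      using that e(2) ball by auto
  qed simp
  moreover have "f (t *\<^sub>R v) \<in> M" if "t \<in> {-e<..<e}" for t
    using that e ball v by (intro L(2)) (auto simp: subspace_scale[OF L(1)])
  ultimately have "curve_through M p (\<lambda>t. f (t *\<^sub>R v))"
    unfolding curve_through_def using e(1) f(2) by auto
  moreover have "((\<lambda>t. t *\<^sub>R v) has_derivative (\<lambda>t. t *\<^sub>R v)) (at (0::real))"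
    by (rule bounded_linear_imp_has_derivative) (rule bounded_linear_scaleR_left)
  from has_derivative_compose[OF this, of f D] f(3)
  have "((\<lambda>t. f (t *\<^sub>R v)) has_derivative (\<lambda>t. D (t *\<^sub>R v))) (at 0)"
    by simp
  then have "((\<lambda>t. f (t *\<^sub>R v)) has_vector_derivative D v) (at 0)"
    unfolding has_vector_derivative_def
    using linear_scale[OF has_derivative_linear[OF f(3)]] by simp
  ultimately show ?thesis unfolding tangent_space_def by blast
qed


section \<open>The unit sphere of a subspace\<close>

text \<open>The inversion with centre \<open>-p\<close> and radius \<open>sqrt 2\<close>; it exchanges the unit sphere with the
  hyperplane orthogonal to the unit vector \<open>p\<close>.\<close>

definition inversion :: "'a::euclidean_space \<Rightarrow> 'a \<Rightarrow> 'a" where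
  "inversion p x = 2 *\<^sub>R (inverse ((x + p) \<bullet> (x + p)) *\<^sub>R (x + p)) - p"

lemma smooth_on_inversion: "smooth_on (- {- p}) (inversion p)"
  unfolding inversion_def
  by (intro smooth_on_diff smooth_on_scaleR smooth_on_bilinear[OF bounded_bilinear_scaleR]
      smooth_on_inverse_norm_squared smooth_on_add smooth_on_id smooth_on_const)
    (auto simp: open_Compl)

lemma inversion_inversion:
  assumes "x \<noteq> - p"
  shows "inversion p x \<noteq> - p" "inversion p (inversion p x) = x"
proof -
  define z where "z = x + p"
  have z: "z \<bullet> z \<noteq> 0" using assms by (simp add: z_def eq_neg_iff_add_eq_0)
  have eq: "inversion p x + p = (2 / (z \<bullet> z)) *\<^sub>R z"
    by (simp add: inversion_def z_def divide_inverse)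
  show "inversion p x \<noteq> - p"
  proof
    assume "inversion p x = - p"
    with eq have "(2 / (z \<bullet> z)) *\<^sub>R z = 0" by simp
    with z show False by auto
  qed
  have "inversion p (inversion p x) + p
      = (2 * inverse ((2 / (z \<bullet> z)) *\<^sub>R z \<bullet> (2 / (z \<bullet> z)) *\<^sub>R z) * (2 / (z \<bullet> z))) *\<^sub>R z"
    unfolding inversion_def[of p "inversion p x"] eq by simp
  also have "2 * inverse ((2 / (z \<bullet> z)) *\<^sub>R z \<bullet> (2 / (z \<bullet> z)) *\<^sub>R z) * (2 / (z \<bullet> z)) = 1"
    using z by (simp add: divide_simps del: inner_eq_zero_iff)
  finally show "inversion p (inversion p x) = x" by (simp add: z_def algebra_simps)
qed

lemma inversion_mem_iff:
  assumes S: "subspace S" and p: "p \<in> S" "norm p = 1" and x: "x \<noteq> - p"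
  shows "x \<in> {x \<in> S. norm x = 1} \<longleftrightarrow> inversion p x \<in> {y \<in> S. p \<bullet> y = 0}"
proof -
  have in_S: "inversion p y \<in> S" if "y \<in> S" for y
    unfolding inversion_def
    by (intro subspace_diff subspace_scale subspace_add S p that)
  then have S_iff: "inversion p x \<in> S \<longleftrightarrow> x \<in> S"
    using inversion_inversion(2)[OF x] by metis
  have pp: "p \<bullet> p = 1" using p(2) by (simp add: dot_square_norm)
  have nz: "(x + p) \<bullet> (x + p) \<noteq> 0" using x by (simp add: eq_neg_iff_add_eq_0)
  have "p \<bullet> inversion p x = 0 \<longleftrightarrow> 2 * (p \<bullet> (x + p)) = (x + p) \<bullet> (x + p)"
  proof -
    have "p \<bullet> inversion p x = 2 * (p \<bullet> (x + p)) / ((x + p) \<bullet> (x + p)) - 1"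
      by (simp only: inversion_def inner_diff_right pp inner_scaleR_right divide_inverse mult_ac)
    with nz show ?thesis by (simp add: divide_eq_eq del: inner_eq_zero_iff)
  qed
  also have "\<dots> \<longleftrightarrow> x \<bullet> x = 1"
    by (auto simp: inner_add_left inner_add_right pp inner_commute)
  finally show ?thesis using S_iff by (simp add: norm_eq_1)
qed

lemma dim_orthogonal_in_subspace:
  fixes S :: "'a::euclidean_space set"
  assumes "subspace S" "p \<in> S" "p \<noteq> 0"
  shows "dim {y \<in> S. p \<bullet> y = 0} + 1 = dim S"
proof -
  have "dim {y \<in> S. \<forall>x\<in>span {p}. orthogonal x y} + dim (span {p}) = dim S"
    using assms by (intro dim_subspace_orthogonal_to_vectors) (auto simp: span_minimal)
  moreover have "{y \<in> S. \<forall>x\<in>span {p}. orthogonal x y} = {y \<in> S. p \<bullet> y = 0}"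
    by (auto simp: span_singleton orthogonal_def)
  ultimately show ?thesis using assms by (simp add: dim_span)
qed

lemma smooth_submanifold_unit_sphere:
  assumes S: "subspace S"
  shows "smooth_submanifold (dim S - 1) {x \<in> S. norm x = 1}"
proof (rule smooth_submanifold_involutive)
  fix p assume "p \<in> {x \<in> S. norm x = 1}"
  then have p: "p \<in> S" "norm p = 1" by auto
  have "subspace {y \<in> S. p \<bullet> y = 0}"
    using S by (auto simp: subspace_def inner_add_right)
  moreover have "dim {y \<in> S. p \<bullet> y = 0} = dim S - 1"
    using dim_orthogonal_in_subspace[OF S p(1)] p by fastforce
  moreover have "p \<noteq> - p"
    using p by (metis norm_zero scaleR_2 scaleR_eq_0_iff zero_neq_numeral zero_neq_one eq_neg_iff_add_eq_0)
  ultimately show "\<exists>U f L. open U \<and> p \<in> U \<and> smooth_on U f \<and> (\<forall>x\<in>U. f x \<in> U \<and> f (f x) = x \<and>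
      (x \<in> {x \<in> S. norm x = 1} \<longleftrightarrow> f x \<in> L)) \<and> subspace L \<and> dim L = dim S - 1"
    using inversion_inversion[of _ p] inversion_mem_iff[OF S p] smooth_on_inversion[of p]
    by (intro exI[of _ "- {- p}"] exI[of _ "inversion p"] exI[of _ "{y \<in> S. p \<bullet> y = 0}"])
      (simp add: open_Compl)
qed

text \<open>The derivative of the inversion at \<open>0\<close> is twice the identity on the orthogonal complement of \<open>p\<close>,
  so lines in that hyperplane produce all tangent vectors.\<close>

lemma tangent_space_unit_sphere:
  assumes S: "subspace S" and p: "p \<in> S" "norm p = 1"
  shows "tangent_space {x \<in> S. norm x = 1} p = {v \<in> S. p \<bullet> v = 0}"
proof (intro equalityI subsetI)
  fix v assume v: "v \<in> tangent_space {x \<in> S. norm x = 1} p"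
  have "(\<lambda>w. p \<bullet> w + w \<bullet> p) v = 0"
    by (rule tangent_derivative_zero[OF v, of "\<lambda>x. x \<bullet> x" _ UNIV 1])
      (use has_derivative_inner[OF has_derivative_ident has_derivative_ident] in \<open>auto simp: norm_eq_1\<close>)
  moreover have "v \<in> S"
  proof -
    obtain y z where yz: "y \<in> span S" "\<And>w. w \<in> span S \<Longrightarrow> orthogonal z w" "v = y + z"
      using orthogonal_subspace_decomp_exists[of S v] by metis
    have "z \<bullet> v = 0"
      by (rule tangent_derivative_zero[OF v, of "\<lambda>x. z \<bullet> x" "\<lambda>x. z \<bullet> x" UNIV 0])
        (use yz in \<open>auto intro!: bounded_linear_imp_has_derivative bounded_linear_inner_right
          simp: span_base orthogonal_def\<close>)
    then have "z \<bullet> z = 0" using yz by (simp add: inner_add_right orthogonal_def)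
    then show ?thesis using yz(1,3) S by (simp add: span_eq_iff[THEN iffD2])
  qed
  ultimately show "v \<in> {v \<in> S. p \<bullet> v = 0}" by (simp add: inner_commute)
next
  fix v assume v: "v \<in> {v \<in> S. p \<bullet> v = 0}"
  let ?L = "{v \<in> S. p \<bullet> v = 0}"
  have L: "subspace ?L" using S by (auto simp: subspace_def inner_add_right)
  have pp: "p \<bullet> p = 1" using p(2) by (simp add: dot_square_norm)
  have 3: "((\<lambda>x. x + p) has_derivative (\<lambda>w. w)) (at 0)"
    using has_derivative_add[OF has_derivative_ident has_derivative_const[of p], of "at 0"] by simp
  have 1: "((\<lambda>x. (x + p) \<bullet> (x + p)) has_derivative (\<lambda>w. p \<bullet> w + w \<bullet> p)) (at 0)"
    using has_derivative_inner[OF 3 3] by simp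
  have 2: "((\<lambda>x. inverse ((x + p) \<bullet> (x + p))) has_derivative (\<lambda>w. - (p \<bullet> w + w \<bullet> p))) (at 0)"
    using Deriv.has_derivative_inverse[OF _ 1] by (simp add: pp)
  have "(inversion p has_derivative (\<lambda>w. 2 *\<^sub>R (w + (- (p \<bullet> w + w \<bullet> p)) *\<^sub>R p))) (at 0)"
    unfolding inversion_def
    using has_derivative_diff[OF has_derivative_scaleR_right[OF has_derivative_scaleR[OF 2 3], of 2]
        has_derivative_const[of p]] by (simp add: pp)
  then have "(\<lambda>w. 2 *\<^sub>R (w + (- (p \<bullet> w + w \<bullet> p)) *\<^sub>R p)) ((1/2) *\<^sub>R v) \<in> tangent_space {x \<in> S. norm x = 1} p"
  proof (rule tangent_space_if_chart[OF _ _ smooth_on_inversion _ _ L, rotated 3])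
    show "inversion p x \<in> {x \<in> S. norm x = 1}" if "x \<in> - {- p} \<inter> ?L" for x
      using that inversion_inversion[of x p] inversion_mem_iff[OF S p, of "inversion p x"] by auto
    show "(1/2) *\<^sub>R v \<in> ?L" using v S by (simp add: subspace_scale)
    show "open (- {- p})" by (simp add: open_Compl)
    show "0 \<in> - {- p}" using p by auto
    show "inversion p 0 = p" by (simp add: inversion_def pp scaleR_2)
  qed
  then show "v \<in> tangent_space {x \<in> S. norm x = 1} p" using v by (simp add: inner_commute)
qed


section \<open>The critical set as a set of involutions\<close>

text \<open>It is \<open>2 A\<close> that squares to the identity; the factor makes the \<open>4 \<times> 4\<close> matrices unit vectors.\<close>

definition involutions :: "('a::conj_algebra^'n^'n) set" where
  "involutions = {A \<in> herm0. A ** A = (1/4) *\<^sub>R mat 1}"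

text \<open>The real part of the trace is invariant under cyclic permutations of a product, so the three terms of the product rule
  agree.\<close>

lemma has_derivative_cubic_form:
  assumes A: "adj A = A"
  shows "(cubic_form has_derivative (\<lambda>v. 3 * ((A ** A) \<bullet> v))) (at A)"
proof -
  note D = bounded_bilinear.FDERIV[OF bounded_bilinear_matrix_mult]
  have "((\<lambda>A. (A ** A ** A) \<bullet> mat 1) has_derivative
      (\<lambda>v. (A ** A ** v + (A ** v + v ** A) ** A) \<bullet> mat 1)) (at A)"
    by (intro has_derivative_inner_left D has_derivative_ident)
  moreover have "(A ** A ** v + (A ** v + v ** A) ** A) \<bullet> mat 1 = 3 * ((A ** A) \<bullet> v)" for v
  proof -
    have "(A ** A ** v) \<bullet> mat 1 = v \<bullet> (A ** A)"
      by (subst matrix_inner_left_adjoint) (simp add: adj_mult A)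
    moreover have "(A ** v ** A) \<bullet> mat 1 = v \<bullet> (A ** A)"
      by (subst matrix_inner_right_adjoint, subst matrix_inner_left_adjoint) (simp add: A)
    moreover have "(v ** A ** A) \<bullet> mat 1 = v \<bullet> (A ** A)"
      by (simp add: matrix_mul_assoc[symmetric], subst matrix_inner_right_adjoint) (simp add: adj_mult A)
    ultimately show ?thesis
      by (simp add: matrix_mult_add_left inner_add_left inner_commute[of "A ** A"])
  qed
  ultimately show ?thesis by (simp add: cubic_form_eq[abs_def])
qed

lemma tangent_space_herm_sphere:
  "A \<in> herm_sphere \<Longrightarrow> tangent_space herm_sphere A = {v \<in> herm0. A \<bullet> v = 0}"
  unfolding herm_sphere_eq by (simp add: tangent_space_unit_sphere[OF subspace_herm0])

lemma critical_point_cubic_form_iff: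
  assumes A: "A \<in> herm_sphere"
  shows "critical_point_on cubic_form herm_sphere A
    \<longleftrightarrow> (\<forall>v \<in> herm0. A \<bullet> v = 0 \<longrightarrow> (A ** A) \<bullet> v = 0)"
proof -
  have adjA: "adj A = A" using A by (simp add: herm_sphere_def mem_herm0_iff)
  have deriv: "((cubic_form \<circ> \<gamma>) has_real_derivative 3 * ((A ** A) \<bullet> v)) (at 0)"
    if "(\<gamma> has_vector_derivative v) (at 0)" "\<gamma> 0 = A" for \<gamma> v
  proof -
    have "((\<lambda>t. cubic_form (\<gamma> t)) has_derivative (\<lambda>t. 3 * ((A ** A) \<bullet> (t *\<^sub>R v)))) (at 0)"
      using has_derivative_compose[OF that(1)[unfolded has_vector_derivative_def], of cubic_form]
        has_derivative_cubic_form[OF adjA] that(2) by blast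
    moreover have "(\<lambda>t. 3 * ((A ** A) \<bullet> (t *\<^sub>R v))) = (*) (3 * ((A ** A) \<bullet> v))"
      by (simp add: fun_eq_iff)
    ultimately show ?thesis by (simp add: has_field_derivative_def o_def)
  qed
  show ?thesis
  proof
    assume crit: "critical_point_on cubic_form herm_sphere A"
    show "\<forall>v \<in> herm0. A \<bullet> v = 0 \<longrightarrow> (A ** A) \<bullet> v = 0"
    proof (intro ballI impI)
      fix v assume "v \<in> herm0" "A \<bullet> v = 0"
      then have "v \<in> tangent_space herm_sphere A" using tangent_space_herm_sphere[OF A] by simp
      then obtain \<gamma> where g: "\<gamma> 0 = A" "curve_through herm_sphere A \<gamma>"
        "(\<gamma> has_vector_derivative v) (at 0)" by (rule tangent_spaceE)
      have "((cubic_form \<circ> \<gamma>) has_real_derivative 0) (at 0)"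
        using crit g(2) unfolding critical_point_on_def by blast
      then show "(A ** A) \<bullet> v = 0"
        using DERIV_unique[OF deriv[OF g(3,1)], of 0] by simp
    qed
  next
    assume *: "\<forall>v \<in> herm0. A \<bullet> v = 0 \<longrightarrow> (A ** A) \<bullet> v = 0"
    show "critical_point_on cubic_form herm_sphere A"
      unfolding critical_point_on_def
    proof (intro conjI allI impI A)
      fix \<gamma> assume g: "curve_through herm_sphere A \<gamma>"
      then obtain e where e: "e > 0" "smooth_on {-e<..<e} \<gamma>" "\<gamma> 0 = A"
        unfolding curve_through_def by auto
      have "(\<gamma> has_derivative frechet_derivative \<gamma> (at 0)) (at 0)"
        using e by (intro smooth_on_has_derivative) auto
      then have d: "(\<gamma> has_vector_derivative vector_derivative \<gamma> (at 0)) (at 0)"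
        using differentiableI vector_derivative_works by blast
      then have "vector_derivative \<gamma> (at 0) \<in> tangent_space herm_sphere A"
        using g unfolding tangent_space_def by blast
      then show "((cubic_form \<circ> \<gamma>) has_real_derivative 0) (at 0)"
        using deriv[OF d e(3)] * tangent_space_herm_sphere[OF A] by simp
    qed
  qed
qed

text \<open>The gradient of \<open>tr A\<^sup>3\<close> is \<open>3 A\<^sup>2\<close>, so at a critical point \<open>A\<^sup>2\<close> is a combination of \<open>A\<close> and
  the identity. The coefficient of \<open>A\<close> is \<open>tr A\<^sup>3 = 0\<close>, and taking traces yields the other one.\<close>

lemma crit_set_eq_involutions: "(crit_set :: ('a::conj_algebra^4^4) set) = involutions"
proof (intro equalityI subsetI)
  fix A :: "'a^4^4" assume "A \<in> crit_set"
  then have A: "A \<in> herm_sphere" "trace (A ** A ** A) = 0"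
    and crit: "\<And>v. v \<in> herm0 \<Longrightarrow> A \<bullet> v = 0 \<Longrightarrow> (A ** A) \<bullet> v = 0"
    by (auto simp: crit_set_def critical_point_cubic_form_iff)
  have h: "adj A = A" "A \<bullet> mat 1 = 0" and n: "A \<bullet> A = 1"
    using A by (auto simp: herm_sphere_eq mem_herm0_iff norm_eq_1)
  have AA1: "(A ** A) \<bullet> mat 1 = 1"
    using n by (subst matrix_inner_right_adjoint) (simp add: h)
  have AAA: "(A ** A) \<bullet> A = 0"
  proof -
    have "(A ** A) \<bullet> A = (A ** A ** A) \<bullet> mat 1"
      by (subst (2) matrix_inner_right_adjoint) (simp add: h)
    then show ?thesis using A(2) trace_inner_one[of "A ** A ** A"] by simp
  qed
  define w where "w = A ** A - (1/4) *\<^sub>R mat 1"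
  have "w \<in> herm0" "A \<bullet> w = 0"
    using AA1 AAA h by (simp_all add: w_def mem_herm0_iff adj_linear adj_mult inner_diff_left
        inner_diff_right inner_mat_one inner_commute)
  then have "(A ** A) \<bullet> w = 0" "mat 1 \<bullet> w = 0"
    using crit[of w] by (simp_all add: mem_herm0_iff inner_commute[of "mat 1"])
  then have "w \<bullet> w = 0" by (simp add: w_def inner_diff_left)
  then show "A \<in> involutions" using A(1) by (simp add: w_def involutions_def herm_sphere_def)
next
  fix A :: "'a^4^4" assume "A \<in> involutions"
  then have A: "A \<in> herm0" "adj A = A" "A \<bullet> mat 1 = 0" and sq: "A ** A = (1/4) *\<^sub>R mat 1"
    by (auto simp: involutions_def mem_herm0_iff)
  have "A \<bullet> A = (A ** A) \<bullet> mat 1"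
    by (subst matrix_inner_right_adjoint) (simp add: A)
  also have "\<dots> = 1" by (simp add: sq inner_mat_one)
  finally have S: "A \<in> herm_sphere" using A(1) by (simp add: herm_sphere_eq norm_eq_1)
  moreover have "trace (A ** A ** A) = 0"
    using A(1) by (simp add: sq matrix_mult_scaleR_left trace_linear herm0_def)
  moreover have "critical_point_on cubic_form herm_sphere A"
    unfolding critical_point_cubic_form_iff[OF S] sq by (simp add: mem_herm0_iff inner_commute)
  ultimately show "A \<in> crit_set" by (simp add: crit_set_def)
qed


section \<open>Charts and tangent spaces of the critical set\<close>

text \<open>The linearisation of \<open>A\<^sup>2 = 1/4\<close> among Hermitian matrices.\<close>

definition anticommutant :: "'a::conj_algebra^'n^'n \<Rightarrow> ('a^'n^'n) set" where
  "anticommutant A = {X. adj X = X \<and> A ** X + X ** A = 0}"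

lemma subspace_anticommutant: "subspace (anticommutant A)"
proof (rule subspaceI)
  show "x + y \<in> anticommutant A" if "x \<in> anticommutant A" "y \<in> anticommutant A" for x y
  proof -
    have "A ** (x + y) + (x + y) ** A = (A ** x + x ** A) + (A ** y + y ** A)"
      by (simp add: matrix_algebra)
    with that show ?thesis by (simp add: anticommutant_def adj_linear)
  qed
qed (simp_all add: anticommutant_def adj_linear matrix_algebra flip: scaleR_add_right)

lemma mem_anticommutantD:
  assumes "X \<in> anticommutant A"
  shows "adj X = X" "X ** A = - (A ** X)"
  using assms by (auto simp: anticommutant_def eq_neg_iff_add_eq_0 add.commute)

lemma involutionsD:
  assumes "A \<in> involutions"
  shows "A \<in> herm0" "adj A = A" "A \<bullet> mat 1 = 0" "A ** A = (1/4) *\<^sub>R mat 1"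
  using assms by (auto simp: involutions_def mem_herm0_iff)

lemma involution_cancel:
  assumes "A \<in> involutions"
  shows "A ** (A ** X) = (1/4) *\<^sub>R X" "X ** A ** A = (1/4) *\<^sub>R X"
proof -
  have "A ** (A ** X) = (A ** A) ** X" by (simp add: matrix_mul_assoc)
  then show "A ** (A ** X) = (1/4) *\<^sub>R X"
    by (simp add: involutionsD(4)[OF assms] matrix_mult_scaleR_left)
  have "X ** A ** A = X ** (A ** A)" by (simp add: matrix_mul_assoc)
  then show "X ** A ** A = (1/4) *\<^sub>R X"
    by (simp add: involutionsD(4)[OF assms] matrix_mult_scaleR_right)
qed

lemma involution_conjugate_anticommutant:
  assumes "A \<in> involutions" "X \<in> anticommutant A"
  shows "A ** X ** A = - ((1/4) *\<^sub>R X)"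
  using mem_anticommutantD(2)[OF assms(2)] involution_cancel(1)[OF assms(1), of X]
  by (simp add: matrix_mul_assoc[symmetric] matrix_mult_minus_right)

text \<open>This is \<open>inversion\<close> with the matrix inverse in place of \<open>z / |z|\<^sup>2\<close>. The factor is chosen for \<open>A0\<^sup>2 = 1/4\<close>, so
  that \<open>A0\<close> is exchanged with \<open>0\<close>.\<close>

definition matrix_inversion :: "'a::conj_algebra^'n^'n \<Rightarrow> 'a^'n^'n \<Rightarrow> 'a^'n^'n" where
  "matrix_inversion A0 A = (1/2) *\<^sub>R matrix_inv (A + A0) - A0"

definition inversion_domain :: "'a::conj_algebra^'n^'n \<Rightarrow> ('a^'n^'n) set" where
  "inversion_domain A0 = {A. A + A0 \<in> invertible_set}"

lemma open_inversion_domain: "open (inversion_domain A0)"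
proof -
  have "inversion_domain A0 = (\<lambda>A. A + A0) -` invertible_set" by (auto simp: inversion_domain_def)
  then show ?thesis
    using open_vimage[OF open_invertible_set, of "\<lambda>A. A + A0"] by (simp add: continuous_intros)
qed

lemma smooth_on_matrix_inversion: "smooth_on (inversion_domain A0) (matrix_inversion A0)"
proof -
  have "smooth_on (inversion_domain A0) (\<lambda>A. matrix_inv (A0 + A))"
    by (rule smooth_on_compose_affine[OF open_invertible_set bounded_linear_ident smooth_on_matrix_inv
          open_inversion_domain]) (simp add: inversion_domain_def add.commute)
  then show ?thesis
    unfolding matrix_inversion_def
    by (intro smooth_on_diff smooth_on_scaleR smooth_on_const open_inversion_domain) (simp add: add.commute)
qed

lemma matrix_inversion_matrix_inversion:
  assumes "A \<in> inversion_domain A0"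
  shows "matrix_inversion A0 A \<in> inversion_domain A0"
    and "matrix_inversion A0 (matrix_inversion A0 A) = A"
proof -
  let ?B = "A + A0"
  have B: "invertible ?B" using assms by (simp add: inversion_domain_def invertible_set_def)
  have "((1/2) *\<^sub>R matrix_inv ?B) ** (2 *\<^sub>R ?B) = mat 1" "(2 *\<^sub>R ?B) ** ((1/2) *\<^sub>R matrix_inv ?B) = mat 1"
    using matrix_inv_both[OF B] by (simp_all add: matrix_mult_scaleR_left matrix_mult_scaleR_right)
  note inv = matrix_inv_unique[OF this]
  show "matrix_inversion A0 A \<in> inversion_domain A0"
    using inv(2) by (simp add: inversion_domain_def invertible_set_def matrix_inversion_def)
  show "matrix_inversion A0 (matrix_inversion A0 A) = A"
    using inv(1) by (simp add: matrix_inversion_def[of _ "matrix_inversion A0 A"])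
      (simp add: matrix_inversion_def)
qed

lemma adj_matrix_inv:
  assumes "invertible A"
  shows "matrix_inv (adj A) = adj (matrix_inv (A :: 'a::conj_algebra^'n^'n))"
proof (rule matrix_inv_unique(1))
  show "adj A ** adj (matrix_inv A) = mat 1" "adj (matrix_inv A) ** adj A = mat 1"
    by (simp_all add: matrix_inv_both[OF assms] flip: adj_mult)
qed

text \<open>With \<open>B = A + A0\<close>, both \<open>A\<^sup>2 = 1/4\<close> and the anticommutation of the image with \<open>A0\<close> say that
  \<open>B\<^sup>2 = B A0 + A0 B\<close>. In that case \<open>A = B A0 B\<^sup>-\<^sup>1\<close>, so that the trace vanishes as well.\<close>

lemma matrix_inversion_mem_anticommutant_iff:
  assumes A0: "A0 \<in> involutions" and A: "A \<in> inversion_domain A0"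
  shows "A \<in> involutions \<longleftrightarrow> matrix_inversion A0 A \<in> anticommutant A0"
proof -
  let ?B = "A + A0" and ?X = "matrix_inversion A0 A"
  define R where "R = matrix_inv ?B"
  have B: "invertible ?B" using A by (simp add: inversion_domain_def invertible_set_def)
  have BR: "?B ** R = mat 1" and RB: "R ** ?B = mat 1"
    using matrix_inv_both[OF B] by (simp_all add: R_def)
  define E where "E = ?B ** A0 + A0 ** ?B - ?B ** ?B"
  have "A ** A = (?B - A0) ** (?B - A0)" by simp
  also have "\<dots> = ?B ** ?B - A0 ** ?B - (?B ** A0 - A0 ** A0)"
    by (simp only: matrix_mult_diff_left matrix_mult_diff_right)
  finally have sq: "A ** A = (1/4) *\<^sub>R mat 1 - E"
    by (simp add: E_def involutionsD(4)[OF A0])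
  have "A0 ** ?X + ?X ** A0 = (1/2) *\<^sub>R (A0 ** R + R ** A0) - (1/2) *\<^sub>R mat 1"
    by (simp add: matrix_inversion_def matrix_mult_diff_left matrix_mult_diff_right
        matrix_mult_scaleR_left matrix_mult_scaleR_right involutionsD(4)[OF A0] R_def
        scaleR_add_right algebra_simps flip: scaleR_add_left)
  also have "\<dots> = (1/2) *\<^sub>R (R ** E ** R)"
  proof -
    have "R ** (C ** A0 + A0 ** C - C ** C) ** R
        = (R ** C) ** (A0 ** R) + (R ** A0) ** (C ** R) - (R ** C) ** (C ** R)" for C
      by (simp only: matrix_mult_diff_left matrix_mult_diff_right matrix_mult_add_left
          matrix_mult_add_right matrix_mul_assoc)
    from this[of ?B] have "R ** E ** R = (R ** ?B) ** (A0 ** R) + (R ** A0) ** (?B ** R) - (R ** ?B) ** (?B ** R)"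
      by (simp only: E_def)
    then show ?thesis by (simp add: BR RB scaleR_diff_right add.commute)
  qed
  finally have anti: "A0 ** ?X + ?X ** A0 = (1/2) *\<^sub>R (R ** E ** R)" .
  have "?B ** (R ** E ** R) ** ?B = (?B ** R) ** E ** (R ** ?B)" by (simp only: matrix_mul_assoc)
  then have "?B ** (R ** E ** R) ** ?B = E" by (simp add: BR RB)
  then have E0: "R ** E ** R = 0 \<longleftrightarrow> E = 0"
    by (metis matrix_mult_zero_left matrix_mult_zero_right)
  have herm: "adj (matrix_inversion A0 Y) = matrix_inversion A0 Y"
    if "Y \<in> inversion_domain A0" "adj Y = Y" for Y
    using adj_matrix_inv[of "Y + A0"] that
    by (simp add: matrix_inversion_def adj_linear involutionsD(2)[OF A0] inversion_domain_def invertible_set_def)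
  have herm_iff: "adj ?X = ?X \<longleftrightarrow> adj A = A"
    using herm[OF A] herm[of ?X] matrix_inversion_matrix_inversion[OF A] by metis
  have trace: "A \<bullet> mat 1 = 0" if "E = 0"
  proof -
    have "C ** (C ** R) = C ** A0 ** R + A0 ** (C ** R)" if "C ** C = C ** A0 + A0 ** C" for C
      by (metis that matrix_mult_add_left matrix_mul_assoc)
    from this[of ?B] that have "?B ** (?B ** R) = ?B ** A0 ** R + A0 ** (?B ** R)"
      by (simp add: E_def)
    then have "A = ?B ** A0 ** R" by (simp add: BR)
    then have "A \<bullet> mat 1 = (?B ** A0) \<bullet> adj R"
      by (metis matrix_inner_right_adjoint matrix_mul_lid)
    also have "\<dots> = A0 \<bullet> adj (R ** ?B)"
      by (simp add: matrix_inner_left_adjoint adj_mult)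
    also have "\<dots> = 0" by (simp add: RB involutionsD(3)[OF A0])
    finally show ?thesis .
  qed
  show ?thesis
    unfolding involutions_def anticommutant_def mem_Collect_eq mem_herm0_iff herm_iff anti
    using E0 sq trace by auto
qed

lemma zero_mem_inversion_domain:
  assumes "A \<in> involutions"
  shows "0 \<in> inversion_domain A" "matrix_inv A = 4 *\<^sub>R A" "invertible A"
proof -
  have "A ** (4 *\<^sub>R A) = mat 1" "(4 *\<^sub>R A) ** A = mat 1"
    by (simp_all add: matrix_mult_scaleR_left matrix_mult_scaleR_right involutionsD(4)[OF assms])
  from matrix_inv_unique[OF this] show "0 \<in> inversion_domain A" "matrix_inv A = 4 *\<^sub>R A" "invertible A"
    by (simp_all add: inversion_domain_def invertible_set_def)
qed

lemma involution_mem_inversion_domain: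
  assumes "A \<in> involutions"
  shows "A \<in> inversion_domain A"
proof -
  have "(2 *\<^sub>R A) ** (2 *\<^sub>R A) = mat 1"
    by (simp add: matrix_mult_scaleR_left matrix_mult_scaleR_right involutionsD(4)[OF assms])
  from matrix_inv_unique(2)[OF this this] show ?thesis
    by (simp add: inversion_domain_def invertible_set_def scaleR_2)
qed

lemma smooth_submanifold_involutions:
  assumes "\<And>A. A \<in> (involutions :: ('a::conj_algebra^'n^'n) set) \<Longrightarrow> dim (anticommutant A) = d"
  shows "smooth_submanifold d (involutions :: ('a^'n^'n) set)"
proof (rule smooth_submanifold_involutive)
  fix A :: "'a^'n^'n" assume A: "A \<in> involutions"
  show "\<exists>U f L. open U \<and> A \<in> U \<and> smooth_on U f \<and> (\<forall>x\<in>U. f x \<in> U \<and> f (f x) = x \<and>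
      (x \<in> involutions \<longleftrightarrow> f x \<in> L)) \<and> subspace L \<and> dim L = d"
    by (intro exI[of _ "inversion_domain A"] exI[of _ "matrix_inversion A"] exI[of _ "anticommutant A"]
        conjI ballI open_inversion_domain smooth_on_matrix_inversion matrix_inversion_matrix_inversion
        involution_mem_inversion_domain matrix_inversion_mem_anticommutant_iff subspace_anticommutant
        assms A)
qed

text \<open>Differentiating the defining equations shows that tangent vectors are Hermitian and anticommute with \<open>A\<close>. Conversely, the derivative of the
  chart at \<open>0\<close> is \<open>X \<mapsto> - 8 A X A\<close>, which is \<open>2 X\<close> on the anticommutant.\<close>

lemma tangent_space_involutions:
  fixes A :: "'a::conj_algebra^'n^'n"
  assumes A: "A \<in> involutions"
  shows "tangent_space involutions A = anticommutant A"
proof (intro equalityI subsetI)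
  fix X assume X: "X \<in> tangent_space involutions A"
  have "A ** X + X ** A = 0"
    by (rule tangent_derivative_zero[OF X bounded_bilinear.FDERIV[OF bounded_bilinear_matrix_mult
            has_derivative_ident has_derivative_ident], of UNIV "(1/4) *\<^sub>R mat 1"])
      (auto simp: involutionsD(4))
  moreover have "adj X - X = 0"
    by (rule tangent_derivative_zero[OF X has_derivative_diff[OF bounded_linear_imp_has_derivative
            has_derivative_ident], of adj UNIV 0])
      (auto simp: involutionsD(2) linear_conv_bounded_linear[symmetric] linear_adj)
  ultimately show "X \<in> anticommutant A" by (simp add: anticommutant_def)
next
  fix X assume X: "X \<in> anticommutant A"
  have "((\<lambda>X. X + A) has_derivative (\<lambda>H. H)) (at 0)"
    using has_derivative_add[OF has_derivative_ident has_derivative_const[of A], of "at 0"] by simp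
  from has_derivative_compose[OF this, of matrix_inv] has_derivative_matrix_inv[OF zero_mem_inversion_domain(3)[OF A]]
  have "((\<lambda>X. matrix_inv (X + A)) has_derivative (\<lambda>H. - (matrix_inv A ** H ** matrix_inv A))) (at 0)"
    by simp
  from has_derivative_diff[OF has_derivative_scaleR_right[OF this, of "1/2"] has_derivative_const[of A]]
  have D: "(matrix_inversion A has_derivative (\<lambda>H. (1/2) *\<^sub>R - (matrix_inv A ** H ** matrix_inv A))) (at 0)"
    by (simp add: matrix_inversion_def[abs_def])
  have "(\<lambda>H. (1/2) *\<^sub>R - (matrix_inv A ** H ** matrix_inv A)) ((1/2) *\<^sub>R X) \<in> tangent_space involutions A"
  proof (rule tangent_space_if_chart[OF open_inversion_domain _ smooth_on_matrix_inversion _ D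
        subspace_anticommutant])
    show "0 \<in> inversion_domain A" "matrix_inversion A 0 = A"
      using zero_mem_inversion_domain[OF A] by (simp_all add: matrix_inversion_def flip: scaleR_left_diff_distrib)
        (metis scaleR_2 add_diff_cancel)
    show "(1/2) *\<^sub>R X \<in> anticommutant A" using X subspace_anticommutant subspace_scale by blast
    show "matrix_inversion A Y \<in> involutions" if "Y \<in> inversion_domain A \<inter> anticommutant A" for Y
      using that matrix_inversion_matrix_inversion[of Y A]
        matrix_inversion_mem_anticommutant_iff[OF A, of "matrix_inversion A Y"] by auto
  qed
  then show "X \<in> tangent_space involutions A"
    by (simp add: involution_conjugate_anticommutant[OF A X] zero_mem_inversion_domain(2)[OF A] matrix_mult_scaleR_left matrix_mult_scaleR_right)
qed


section \<open>Normal spaces and shape operators\<close>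

lemma involution_inner_self: "A \<in> (involutions :: ('a::conj_algebra^4^4) set) \<Longrightarrow> A \<bullet> A = 1"
  using crit_set_eq_involutions by (auto simp: crit_set_def herm_sphere_eq norm_eq_1)

lemma anticommutant_subset_tangent_herm_sphere:
  fixes A :: "'a::conj_algebra^4^4"
  assumes A: "A \<in> involutions"
  shows "anticommutant A \<subseteq> tangent_space herm_sphere A"
proof -
  have "involutions \<subseteq> (herm_sphere :: ('a^4^4) set)"
    using crit_set_eq_involutions by (auto simp: crit_set_def)
  then have "tangent_space involutions A \<subseteq> tangent_space herm_sphere A"
    unfolding tangent_space_def curve_through_def by blast
  then show ?thesis by (simp add: tangent_space_involutions[OF A])
qed

text \<open>A Hermitian \<open>Z\<close> is the sum of \<open>(Z + 4 A Z A) / 2\<close>, which commutes with \<open>A\<close>, and \<open>(Z - 4 A Z A) / 2\<close>, which anticommutes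
  with \<open>A\<close>. The two parts are orthogonal since \<open>Z \<mapsto> 4 A Z A\<close> is self-adjoint.\<close>

lemma anticommutant_projection:
  assumes "A \<in> involutions" "adj Z = Z"
  shows "Z - 4 *\<^sub>R (A ** Z ** A) \<in> anticommutant A"
proof -
  have "A ** (A ** Z ** A) = (1/4) *\<^sub>R (Z ** A)"
    using involution_cancel(1)[OF assms(1), of "Z ** A"] by (simp add: matrix_mul_assoc)
  then have "A ** (Z - 4 *\<^sub>R (A ** Z ** A)) + (Z - 4 *\<^sub>R (A ** Z ** A)) ** A = 0"
    by (simp add: matrix_mult_diff_left matrix_mult_diff_right matrix_mult_scaleR_left
        matrix_mult_scaleR_right involution_cancel(2)[OF assms(1)])
  then show ?thesis
    by (simp add: anticommutant_def adj_linear adj_mult assms(2) involutionsD(2)[OF assms(1)] matrix_mul_assoc)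
qed

lemma inner_involution_conjugate:
  assumes "A \<in> involutions"
  shows "(A ** X ** A) \<bullet> Y = X \<bullet> (A ** Y ** A)"
  by (simp add: matrix_inner_right_adjoint[of _ A] matrix_inner_left_adjoint[of A] involutionsD(2)[OF assms] matrix_mul_assoc)

text \<open>A Hermitian matrix is orthogonal to the anticommutant iff its anticommuting part vanishes.\<close>

lemma normal_space_involutions:
  fixes A :: "'a::conj_algebra^4^4"
  assumes A: "A \<in> involutions"
  shows "normal_space herm_sphere involutions A = {\<xi> \<in> herm0. A \<bullet> \<xi> = 0 \<and> A ** \<xi> = \<xi> ** A}"
proof -
  have "A \<in> herm_sphere" using A by (simp add: herm_sphere_eq involutionsD(1) norm_eq_1 involution_inner_self)
  then have T: "tangent_space herm_sphere A = {v \<in> herm0. A \<bullet> v = 0}" by (rule tangent_space_herm_sphere)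
  have "(\<forall>X \<in> anticommutant A. \<xi> \<bullet> X = 0) \<longleftrightarrow> A ** \<xi> = \<xi> ** A" if "adj \<xi> = \<xi>" for \<xi>
  proof
    assume orth: "\<forall>X \<in> anticommutant A. \<xi> \<bullet> X = 0"
    define Y where "Y = \<xi> - 4 *\<^sub>R (A ** \<xi> ** A)"
    have Y: "Y \<in> anticommutant A"
      unfolding Y_def by (rule anticommutant_projection[OF A that])
    then have "\<xi> \<bullet> Y = 0" using orth by blast
    moreover have "(A ** \<xi> ** A) \<bullet> Y = - ((1/4) *\<^sub>R (\<xi> \<bullet> Y))"
      using inner_involution_conjugate[OF A, of \<xi> Y] involution_conjugate_anticommutant[OF A Y] by simp
    moreover have "Y \<bullet> Y = \<xi> \<bullet> Y - 4 * ((A ** \<xi> ** A) \<bullet> Y)"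
      by (subst (1) Y_def) (simp add: inner_diff_left)
    ultimately have "Y \<bullet> Y = 0" by simp
    then have "\<xi> = 4 *\<^sub>R (A ** \<xi> ** A)" by (simp add: Y_def)
    then have "A ** \<xi> = A ** (4 *\<^sub>R (A ** \<xi> ** A))" by (rule arg_cong)
    also have "\<dots> = 4 *\<^sub>R (A ** (A ** (\<xi> ** A)))" by (simp add: matrix_mult_scaleR_right matrix_mul_assoc)
    also have "\<dots> = \<xi> ** A" by (simp add: involution_cancel[OF A] matrix_mult_scaleR_right)
    finally show "A ** \<xi> = \<xi> ** A" .
  next
    assume comm: "A ** \<xi> = \<xi> ** A"
    show "\<forall>X \<in> anticommutant A. \<xi> \<bullet> X = 0"
    proof
      fix X assume X: "X \<in> anticommutant A"
      have "A ** \<xi> ** A = (1/4) *\<^sub>R \<xi>" by (simp add: comm involution_cancel[OF A])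
      then have "(1/4) * (\<xi> \<bullet> X) = (A ** \<xi> ** A) \<bullet> X" by simp
      also have "\<dots> = - ((1/4) * (\<xi> \<bullet> X))"
        using inner_involution_conjugate[OF A, of \<xi> X] involution_conjugate_anticommutant[OF A X] by simp
      finally show "\<xi> \<bullet> X = 0" by simp
    qed
  qed
  then show ?thesis
    unfolding normal_space_def T tangent_space_involutions[OF A] by (auto simp: mem_herm0_iff)
qed

lemma orth_proj_eqI:
  assumes "subspace T" "w \<in> T" "\<And>u. u \<in> T \<Longrightarrow> (v - w) \<bullet> u = 0"
  shows "orth_proj T v = w"
  unfolding orth_proj_def
proof (rule the_equality)
  fix w' assume w': "w' \<in> T \<and> (\<forall>u\<in>T. (v - w') \<bullet> u = 0)"
  then have "w' - w \<in> T" using assms subspace_diff by blast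
  then have "(w' - w) \<bullet> (w' - w) = (v - w) \<bullet> (w' - w) - (v - w') \<bullet> (w' - w)"
    by (simp add: inner_diff_left)
  also have "\<dots> = 0" using w' assms(3) \<open>w' - w \<in> T\<close> by simp
  finally show "w' = w" by simp
qed (use assms in auto)

lemma orth_proj_orthogonal:
  assumes "subspace T" "u \<in> T"
  shows "(v - orth_proj T v) \<bullet> u = 0"
proof -
  obtain y z where "y \<in> span T" "\<And>w. w \<in> span T \<Longrightarrow> orthogonal z w" "v = y + z"
    using orthogonal_subspace_decomp_exists[of T v] by metis
  then have "y \<in> T" "\<And>w. w \<in> T \<Longrightarrow> (v - y) \<bullet> w = 0"
    using assms(1) by (auto simp: orthogonal_def span_base span_eq_iff[THEN iffD2])
  then show ?thesis using orth_proj_eqI[OF assms(1)] assms(2) by metis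
qed

text \<open>For a normal field \<open>\<nu>\<close>, the derivative of \<open>\<nu> A - A \<nu> = 0\<close> in direction \<open>X\<close> determines the commutator
  of \<open>Z = D \<nu> X\<close> with \<open>A\<close>, and the tangential part of \<open>Z\<close> is \<open>(Z - 4 A Z A) / 2\<close>.\<close>

lemma shape_operator_involutions:
  fixes A :: "'a::conj_algebra^4^4"
  assumes A: "A \<in> involutions" and \<xi>: "\<xi> \<in> normal_space herm_sphere involutions A"
    and X: "X \<in> anticommutant A"
  shows "shape_operator herm_sphere involutions A \<xi> X = - (2 *\<^sub>R (A ** \<xi> ** X + X ** A ** \<xi>))"
proof -
  have S: "A \<in> herm_sphere" using A by (simp add: herm_sphere_eq involutionsD(1) norm_eq_1 involution_inner_self)
  let ?N = "tangent_space herm_sphere A" and ?T = "anticommutant A"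
  have TN: "?T \<subseteq> ?N" by (rule anticommutant_subset_tangent_herm_sphere[OF A])
  have subN: "subspace ?N"
    unfolding tangent_space_herm_sphere[OF S] using subspace_herm0
    by (auto simp: subspace_def inner_add_right)
  have \<xi>': "adj \<xi> = \<xi>" "\<xi> \<bullet> mat 1 = 0" "A \<bullet> \<xi> = 0" "A ** \<xi> = \<xi> ** A"
    using \<xi> by (auto simp: normal_space_involutions[OF A] mem_herm0_iff)
  let ?W = "2 *\<^sub>R (A ** \<xi> ** X + X ** A ** \<xi>)"
  have projected: "orth_proj (tangent_space involutions A) (levi_civita herm_sphere \<nu> A X) = ?W"
    if \<nu>: "normal_extension herm_sphere involutions A \<xi> \<nu>" for \<nu>
  proof -
    obtain U where U: "open U" "A \<in> U" "smooth_on U \<nu>"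
      and normal: "\<And>q. q \<in> U \<inter> involutions \<Longrightarrow> \<nu> q \<in> normal_space herm_sphere involutions q"
      and at_A: "\<nu> A = \<xi>"
      using \<nu> unfolding normal_extension_def by blast
    let ?D = "frechet_derivative \<nu> (at A)"
    define Z where "Z = ?D X"
    have D: "(\<nu> has_derivative ?D) (at A)"
      using smooth_on_has_derivative U by blast
    have comm: "q ** \<nu> q = \<nu> q ** q" and herm: "adj (\<nu> q) = \<nu> q" if "q \<in> U \<inter> involutions" for q
      using normal[OF that] that by (auto simp: normal_space_involutions mem_herm0_iff)
    have X': "X \<in> tangent_space involutions A" using X tangent_space_involutions[OF A] by simp
    note bil = bounded_bilinear.FDERIV[OF bounded_bilinear_matrix_mult]
    have "(\<nu> A ** X + ?D X ** A) - (A ** ?D X + X ** \<nu> A) = 0"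
      by (rule tangent_derivative_zero[OF X' has_derivative_diff[OF bil[OF D has_derivative_ident]
              bil[OF has_derivative_ident D]] U(1,2), of 0]) (simp add: comm)
    then have Z: "Z ** A - A ** Z = X ** \<xi> - \<xi> ** X"
      by (simp add: Z_def at_A algebra_simps)
    have "adj (?D X) - ?D X = 0"
      by (rule tangent_derivative_zero[OF X' has_derivative_diff[OF
              bounded_linear.has_derivative[OF linear_adj[unfolded linear_conv_bounded_linear] D] D] U(1,2), of 0])
        (simp add: herm)
    then have adjZ: "adj Z = Z" by (simp add: Z_def)
    have W: "?W = (1/2) *\<^sub>R (Z - 4 *\<^sub>R (A ** Z ** A))"
    proof -
      have "A ** (Z ** A - A ** Z) = A ** Z ** A - (1/4) *\<^sub>R Z"
        by (simp add: matrix_mult_diff_right involutionsD(4)[OF A] matrix_mul_assoc matrix_mult_scaleR_left)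
      moreover have "A ** (X ** \<xi> - \<xi> ** X) = - (X ** A ** \<xi> + A ** \<xi> ** X)"
        by (simp add: matrix_mult_diff_right matrix_mul_assoc mem_anticommutantD(2)[OF X] matrix_mult_minus_left)
      ultimately have "A ** Z ** A - (1/4) *\<^sub>R Z = - (X ** A ** \<xi> + A ** \<xi> ** X)"
        unfolding Z by simp
      then have "A ** Z ** A = (1/4) *\<^sub>R Z - (A ** \<xi> ** X + X ** A ** \<xi>)"
        by (simp add: algebra_simps)
      then show ?thesis by (simp add: scaleR_diff_right)
    qed
    have W_T: "?W \<in> ?T"
    proof -
      have "Z - 4 *\<^sub>R (A ** Z ** A) \<in> ?T" by (rule anticommutant_projection[OF A adjZ])
      then show ?thesis unfolding W by (rule subspace_scale[OF subspace_anticommutant])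
    qed
    have orth: "(Z - ?W) \<bullet> u = 0" if "u \<in> ?T" for u
      using inner_involution_conjugate[OF A, of Z u] involution_conjugate_anticommutant[OF A that]
      unfolding W by (simp add: inner_diff_left)
    have "(orth_proj ?N Z - ?W) \<bullet> u = 0" if "u \<in> ?T" for u
    proof -
      have "(orth_proj ?N Z - ?W) \<bullet> u = (Z - ?W) \<bullet> u - (Z - orth_proj ?N Z) \<bullet> u"
        by (simp add: inner_diff_left)
      then show ?thesis using orth[OF that] orth_proj_orthogonal[OF subN, of u Z] that TN by auto
    qed
    then show ?thesis
      unfolding levi_civita_def tangent_space_involutions[OF A] Z_def[symmetric]
      by (intro orth_proj_eqI[OF subspace_anticommutant W_T])
  qed
  \<comment> \<open>A normal field through \<open>\<xi>\<close>: at \<open>q\<close>, take the part of \<open>\<xi>\<close> that commutes with \<open>q\<close> and make it orthogonal to \<open>q\<close>.\<close>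
  define \<nu> where "\<nu> q = (1/2) *\<^sub>R (\<xi> + 4 *\<^sub>R (q ** \<xi> ** q)) - (\<xi> \<bullet> q) *\<^sub>R q" for q
  have "normal_extension herm_sphere involutions A \<xi> \<nu>"
    unfolding normal_extension_def
  proof (intro conjI exI[of _ UNIV] ballI)
    show "smooth_on UNIV \<nu>"
      unfolding \<nu>_def
      by (intro smooth_on_diff smooth_on_scaleR smooth_on_add smooth_on_const smooth_on_id open_UNIV
          smooth_on_bilinear[OF bounded_bilinear_matrix_mult] smooth_on_bilinear[OF bounded_bilinear_scaleR]
          smooth_on_bilinear[OF bounded_bilinear_inner])
    show "\<nu> A = \<xi>"
      using \<xi>' by (simp add: \<nu>_def involution_cancel[OF A] inner_commute flip: scaleR_2)
    fix q :: "'a^4^4" assume "q \<in> UNIV \<inter> involutions"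
    then have q: "q \<in> involutions" by simp
    let ?C = "q ** \<xi> ** q"
    have "?C \<bullet> mat 1 = 0"
      using inner_involution_conjugate[OF q, of \<xi> "mat 1"] by (simp add: involutionsD(4)[OF q] \<xi>')
    then have "\<nu> q \<bullet> mat 1 = 0"
      by (simp add: \<nu>_def inner_diff_left inner_add_left \<xi>' involutionsD(3)[OF q])
    moreover have "adj (\<nu> q) = \<nu> q"
      by (simp add: \<nu>_def adj_linear adj_mult \<xi>' involutionsD(2)[OF q] matrix_mul_assoc)
    moreover have "?C \<bullet> q = (1/4) * (\<xi> \<bullet> q)"
      using inner_involution_conjugate[OF q, of \<xi> q]
      by (simp add: involutionsD(4)[OF q] matrix_mult_scaleR_left)
    then have "\<nu> q \<bullet> q = 0"
      by (simp add: \<nu>_def inner_diff_left inner_add_left involution_inner_self[OF q])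
    moreover have "q ** ?C = (1/4) *\<^sub>R (\<xi> ** q)" "?C ** q = (1/4) *\<^sub>R (q ** \<xi>)"
      using involution_cancel(1)[OF q, of "\<xi> ** q"] involution_cancel(2)[OF q, of "q ** \<xi>"]
      by (simp_all add: matrix_mul_assoc)
    then have "q ** \<nu> q = \<nu> q ** q"
      by (simp add: \<nu>_def matrix_mult_diff_left matrix_mult_diff_right matrix_mult_add_left
          matrix_mult_add_right matrix_mult_scaleR_left matrix_mult_scaleR_right add.commute)
    ultimately show "\<nu> q \<in> normal_space herm_sphere involutions q"
      unfolding normal_space_involutions[OF q] by (simp add: mem_herm0_iff inner_commute[of q])
  qed auto
  then show ?thesis
    unfolding shape_operator_def using projected by (intro the_equality) auto
qed


section \<open>Block decomposition\<close>

lemma adj_self_mult_one_column: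
  fixes w :: "'a::conj_algebra^1^'n"
  shows "adj w ** w = (w \<bullet> w) *\<^sub>R mat 1"
proof -
  have "w \<bullet> w = (\<Sum>k\<in>UNIV. w $ k $ 1 \<bullet> w $ k $ 1)"
    by (simp add: inner_vec_def)
  then show ?thesis
    by (simp add: vec_eq_iff matrix_matrix_mult_def adj_def mat_def conjugate_mult_self scaleR_sum_left forall_1)
qed

definition projection :: "'a::conj_algebra^'n^'n \<Rightarrow> bool" where
  "projection Q \<longleftrightarrow> adj Q = Q \<and> Q ** Q = Q"

lemma projection_zero_if_trace_zero:
  assumes "projection Q" "Q \<bullet> mat 1 = 0"
  shows "Q = 0"
proof -
  have "Q \<bullet> Q = (Q ** Q) \<bullet> mat 1"
    using assms(1) by (subst matrix_inner_right_adjoint) (simp add: projection_def)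
  then show ?thesis using assms by (simp add: projection_def)
qed

text \<open>A nonzero column of \<open>Q\<close> lies in the range of \<open>Q\<close>; normalised, it spans a line that can be split off. Column vectors are
  matrices with one column, so that matrix algebra applies to them.\<close>

lemma projection_split_unit_vector:
  fixes Q :: "'a::conj_algebra^'n^'n"
  assumes Q: "projection Q" "Q \<noteq> 0"
  obtains u :: "'a^1^'n" where "adj u ** u = mat 1" "Q ** u = u" "projection (Q - u ** adj u)"
    "(Q - u ** adj u) \<bullet> mat 1 = Q \<bullet> mat 1 - 1" "adj u ** (Q - u ** adj u) = 0"
proof -
  obtain i j where "Q $ i $ j \<noteq> 0" using Q(2) by (auto simp: vec_eq_iff)
  define e :: "'a^1^'n" where "e = (\<chi> k l. if k = j then 1 else 0)"
  define w where "w = Q ** e"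
  have "w $ i $ 1 = Q $ i $ j"
    by (simp add: w_def e_def matrix_matrix_mult_def if_distrib cong: if_cong)
  then have w0: "w \<noteq> 0" using \<open>Q $ i $ j \<noteq> 0\<close> by auto
  have Qw: "Q ** w = w" using Q by (simp add: w_def matrix_mul_assoc projection_def)
  define u where "u = (1 / norm w) *\<^sub>R w"
  have uu: "adj u ** u = mat 1"
    using w0 by (simp add: u_def adj_linear matrix_mult_scaleR_left matrix_mult_scaleR_right
        adj_self_mult_one_column dot_square_norm power2_eq_square)
  have Qu: "Q ** u = u" by (simp add: u_def matrix_mult_scaleR_right Qw)
  have uQ: "adj u ** Q = adj u"
    using arg_cong[OF Qu, of adj] Q by (simp add: adj_mult projection_def)
  have uR: "adj u ** (Q - u ** adj u) = 0"
    by (simp add: matrix_mult_diff_right uQ matrix_mul_assoc uu)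
  have "(Q - u ** adj u) ** (Q - u ** adj u)
      = (Q ** Q - (Q ** u) ** adj u) - u ** (adj u ** (Q - u ** adj u))"
    by (simp add: matrix_mult_diff_left matrix_mult_diff_right matrix_mul_assoc)
  then have P: "projection (Q - u ** adj u)"
    using Q uR by (simp add: projection_def Qu matrix_mult_zero_right adj_linear adj_mult)
  have "(u ** adj u) \<bullet> mat 1 = (adj u ** u) \<bullet> mat 1"
    by (simp add: matrix_inner_left_adjoint matrix_inner_right_adjoint)
       (metis inner_adj adj_adj)
  then have "(u ** adj u) \<bullet> mat 1 = 1" by (simp add: uu inner_mat_one)
  with that uu Qu P uR show thesis by (simp add: inner_diff_left)
qed

text \<open>The trace drops by one with each unit vector that is split off, and a projection of trace zero vanishes. So two vectors
  exhaust \<open>Q\<close>; they form the columns of \<open>V\<close>.\<close>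

lemma projection_factorization:
  fixes Q :: "'a::conj_algebra^'n^'n"
  assumes Q: "projection Q" "Q \<bullet> mat 1 = 2"
  obtains V :: "'a^2^'n" where "adj V ** V = mat 1" "V ** adj V = Q"
proof -
  have "Q \<noteq> 0" using Q(2) by auto
  then obtain u :: "'a^1^'n" where u: "adj u ** u = mat 1" and P: "projection (Q - u ** adj u)"
    "(Q - u ** adj u) \<bullet> mat 1 = Q \<bullet> mat 1 - 1" "adj u ** (Q - u ** adj u) = 0"
    using projection_split_unit_vector[OF Q(1)] by metis
  have "Q - u ** adj u \<noteq> 0" using P(2) Q(2) by auto
  then obtain v :: "'a^1^'n" where v: "adj v ** v = mat 1" "(Q - u ** adj u) ** v = v"
    and R: "projection (Q - u ** adj u - v ** adj v)"
    "(Q - u ** adj u - v ** adj v) \<bullet> mat 1 = (Q - u ** adj u) \<bullet> mat 1 - 1"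
    using projection_split_unit_vector[OF P(1)] by metis
  have "Q - u ** adj u - v ** adj v = 0"
    by (rule projection_zero_if_trace_zero[OF R(1)]) (simp add: R(2) P(2) Q(2))
  then have sum: "u ** adj u + v ** adj v = Q" by (simp add: algebra_simps)
  have "adj u ** v = adj u ** ((Q - u ** adj u) ** v)" using v(2) by simp
  then have uv: "adj u ** v = 0" by (simp add: matrix_mul_assoc P(3) matrix_mult_zero_left)
  have vu: "adj v ** u = 0" using arg_cong[OF uv, of adj] by (simp add: adj_mult adj_linear)
  define V :: "'a^2^'n" where "V = (\<chi> i j. if j = 1 then u $ i $ 1 else v $ i $ 1)"
  have entry: "(adj V ** V) $ i $ j
      = (adj (if i = 1 then u else v) ** (if j = 1 then u else v)) $ 1 $ 1" for i j
    by (simp add: matrix_matrix_mult_def adj_def V_def)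
  show thesis
  proof
    show "V ** adj V = Q"
      unfolding sum[symmetric] by (simp add: vec_eq_iff V_def matrix_matrix_mult_def adj_def sum_2)
    show "adj V ** V = mat 1"
      by (simp only: vec_eq_iff forall_2 entry) (simp add: u v uv vu mat_def)
  qed
qed

text \<open>The columns of \<open>V\<close> and \<open>W\<close> are orthonormal bases of the eigenspaces of \<open>A\<close> for \<open>1/2\<close> and \<open>-1/2\<close>. The eigenspaces are
  two-dimensional because \<open>A\<close> has trace zero.\<close>

lemma involution_blocks:
  fixes A :: "'a::conj_algebra^4^4"
  assumes A: "A \<in> involutions"
  obtains V W :: "'a^2^4" where "adj V ** V = mat 1" "adj W ** W = mat 1" "adj V ** W = 0" "adj W ** V = 0"
    "V ** adj V + W ** adj W = mat 1" "V ** adj V - W ** adj W = 2 *\<^sub>R A"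
proof -
  have P: "projection ((1/2) *\<^sub>R mat 1 + c *\<^sub>R A)" "((1/2) *\<^sub>R mat 1 + c *\<^sub>R A) \<bullet> mat 1 = 2" if "c * c = 1" for c
  proof -
    show "((1/2) *\<^sub>R mat 1 + c *\<^sub>R A) \<bullet> mat 1 = 2"
      by (simp add: inner_add_left inner_mat_one involutionsD(3)[OF A])
    have "((1/2) *\<^sub>R mat 1 + c *\<^sub>R A) ** ((1/2) *\<^sub>R mat 1 + c *\<^sub>R A)
        = (1/4 + (c * c) / 4) *\<^sub>R mat 1 + c *\<^sub>R A"
      by (simp add: matrix_mult_add_left matrix_mult_add_right matrix_mult_scaleR_left
          matrix_mult_scaleR_right involutionsD(4)[OF A] scaleR_add_left flip: scaleR_add_left)
        (simp add: algebra_simps flip: scaleR_add_left)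
    then show "projection ((1/2) *\<^sub>R mat 1 + c *\<^sub>R A)"
      by (simp add: projection_def that adj_linear involutionsD(2)[OF A])
  qed
  obtain V :: "'a^2^4" where V: "adj V ** V = mat 1" "V ** adj V = (1/2) *\<^sub>R mat 1 + 1 *\<^sub>R A"
    using projection_factorization[OF P[of 1]] by auto
  obtain W :: "'a^2^4" where W: "adj W ** W = mat 1" "W ** adj W = (1/2) *\<^sub>R mat 1 + (- 1) *\<^sub>R A"
    using projection_factorization[OF P[of "-1"]] by auto
  have one: "V ** adj V + W ** adj W = mat 1"
    unfolding V W by (simp flip: scaleR_add_left)
  have "adj V ** W = adj V ** (V ** adj V + W ** adj W) ** W" by (simp add: one)
  also have "\<dots> = (adj V ** V) ** (adj V ** W) + (adj V ** W) ** (adj W ** W)"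
    by (simp add: matrix_mult_add_left matrix_mult_add_right matrix_mul_assoc)
  finally have VW: "adj V ** W = 0" by (simp add: V W)
  have "adj W ** V = 0"
    using arg_cong[OF VW, of adj] by (simp add: adj_mult adj_linear)
  moreover have "V ** adj V - W ** adj W = 2 *\<^sub>R A" unfolding V W by (simp add: scaleR_2)
  ultimately show thesis using that V(1) W(1) VW one by blast
qed

lemma blocks_mult:
  fixes V W :: "'a::conj_algebra^2^4"
  assumes "adj V ** V = mat 1" "adj W ** W = mat 1" "adj V ** W = 0" "adj W ** V = 0"
  shows "adj V ** (V ** X) = X" "adj W ** (W ** X) = X" "adj V ** (W ** X) = 0" "adj W ** (V ** X) = 0"
  by (simp_all add: matrix_mul_assoc assms matrix_mult_zero_left)

lemma inner_compression:
  fixes V :: "'a::conj_algebra^'m^'n"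
  shows "(adj V ** X ** V) \<bullet> mat 1 = X \<bullet> (V ** adj V)"
proof -
  have "(adj V ** X ** V) \<bullet> mat 1 = (adj V ** (X ** V)) \<bullet> mat 1" by (simp add: matrix_mul_assoc)
  also have "\<dots> = (X ** V) \<bullet> V" by (subst matrix_inner_left_adjoint) simp
  also have "\<dots> = X \<bullet> (V ** adj V)" by (rule matrix_inner_right_adjoint)
  finally show ?thesis .
qed

text \<open>Relative to the blocks, the anticommutant consists of the matrices \<open>(0, x; x*, 0)\<close> with \<open>x\<close> an arbitrary \<open>2 \<times> 2\<close> matrix.\<close>

lemma dim_anticommutant:
  fixes A :: "'a::conj_algebra^4^4"
  assumes A: "A \<in> involutions"
  shows "dim (anticommutant A) = 4 * DIM('a)"
proof -
  obtain V W :: "'a^2^4" where VW: "adj V ** V = mat 1" "adj W ** W = mat 1" "adj V ** W = 0" "adj W ** V = 0"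
    and one: "V ** adj V + W ** adj W = mat 1" and diff: "V ** adj V - W ** adj W = 2 *\<^sub>R A"
    using involution_blocks[OF A] .
  note bl = blocks_mult[OF VW]
  define F where "F x = V ** x ** adj W + W ** adj x ** adj V" for x :: "'a^2^2"
  have lin: "linear F"
    by (rule linearI) (simp_all add: F_def adj_linear matrix_algebra scaleR_add_right)
  have left_inv: "adj V ** F x ** W = x" for x
    by (simp add: F_def matrix_mult_add_left matrix_mult_add_right matrix_mul_assoc[symmetric] VW bl
        matrix_mult_zero_right)
  have "F x \<in> anticommutant A" for x
  proof -
    have "2 *\<^sub>R (A ** F x + F x ** A) = (V ** adj V - W ** adj W) ** F x + F x ** (V ** adj V - W ** adj W)"
      unfolding diff by (simp add: matrix_mult_scaleR_left matrix_mult_scaleR_right scaleR_add_right)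
    also have "\<dots> = 0"
      by (simp add: F_def matrix_mult_add_left matrix_mult_add_right matrix_mult_diff_left
          matrix_mult_diff_right matrix_mul_assoc[symmetric] bl matrix_mult_zero_right)
    finally have "A ** F x + F x ** A = 0" by simp
    moreover have "adj (F x) = F x"
      by (simp add: F_def adj_linear adj_mult matrix_mul_assoc add.commute)
    ultimately show ?thesis by (simp add: anticommutant_def)
  qed
  moreover have "X \<in> range F" if X: "X \<in> anticommutant A" for X
  proof -
    have AX: "(V ** adj V - W ** adj W) ** X + X ** (V ** adj V - W ** adj W) = 0"
      using X unfolding diff anticommutant_def
      by (simp add: matrix_mult_scaleR_left matrix_mult_scaleR_right flip: scaleR_add_right)
    have "adj V ** ((V ** adj V - W ** adj W) ** X + X ** (V ** adj V - W ** adj W)) ** V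
        = 2 *\<^sub>R (adj V ** X ** V)"
      by (simp add: matrix_mult_add_left matrix_mult_add_right matrix_mult_diff_left
          matrix_mult_diff_right matrix_mul_assoc[symmetric] VW bl matrix_mult_zero_right scaleR_2)
    then have VXV: "adj V ** X ** V = 0" by (simp add: AX matrix_mult_zero_left matrix_mult_zero_right)
    have "adj W ** ((V ** adj V - W ** adj W) ** X + X ** (V ** adj V - W ** adj W)) ** W
        = - (2 *\<^sub>R (adj W ** X ** W))"
      by (simp add: matrix_mult_add_left matrix_mult_add_right matrix_mult_diff_left
          matrix_mult_diff_right matrix_mul_assoc[symmetric] VW bl matrix_mult_zero_right scaleR_2)
    then have WXW: "adj W ** X ** W = 0" by (simp add: AX matrix_mult_zero_left matrix_mult_zero_right)
    have "X = (V ** adj V + W ** adj W) ** X ** (V ** adj V + W ** adj W)" by (simp add: one)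
    also have "\<dots> = V ** (adj V ** X ** V) ** adj V + V ** (adj V ** X ** W) ** adj W
        + (W ** (adj W ** X ** V) ** adj V + W ** (adj W ** X ** W) ** adj W)"
      by (simp add: matrix_mult_add_left matrix_mult_add_right matrix_mul_assoc)
    also have "\<dots> = F (adj V ** X ** W)"
      using mem_anticommutantD(1)[OF X]
      by (simp add: VXV WXW F_def adj_mult matrix_mult_zero_left matrix_mult_zero_right matrix_mul_assoc)
    finally show ?thesis by blast
  qed
  ultimately have range: "anticommutant A = range F" by blast
  have "inj F" using left_inv by (metis injI)
  then have "dim (range F) = dim (UNIV :: ('a^2^2) set)"
    by (intro dim_image_eq[OF lin]) simp
  then show ?thesis by (simp add: range)
qed

text \<open>A Hermitian \<open>2 \<times> 2\<close> matrix of trace zero is \<open>(s, q; q*, -s)\<close> with real \<open>s\<close>; it anticommutes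
  with every such matrix \<open>(t, r; r*, -t)\<close> orthogonal to it, and the square of the latter is \<open>t\<^sup>2 + |r|\<^sup>2\<close>.\<close>

lemma anticommuting_involution_2x2:
  fixes a :: "'a::conj_algebra^2^2"
  assumes "adj a = a" "a \<bullet> mat 1 = 0"
  obtains g where "adj g = g" "g ** g = mat 1" "g ** a = - (a ** g)"
proof -
  define s where "s = a $ 1 $ 1 \<bullet> 1"
  define q where "q = a $ 1 $ 2"
  have c: "conjugate (a $ 1 $ 1) = a $ 1 $ 1" "conjugate (a $ 1 $ 2) = a $ 2 $ 1"
    "conjugate (a $ 2 $ 2) = a $ 2 $ 2"
    using assms(1) by (auto simp: adj_def vec_eq_iff)
  have "trace a = 0" using assms hermitian_trace_real[of a] by simp
  then have "a $ 2 $ 2 = - (a $ 1 $ 1)"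
    by (simp add: trace_def sum_2 eq_neg_iff_add_eq_0 add.commute)
  moreover have "a $ 1 $ 1 = s *\<^sub>R 1" using self_conjugate_real[OF c(1)] by (simp add: s_def)
  ultimately have a: "a $ 1 $ 1 = s *\<^sub>R 1" "a $ 2 $ 2 = - (s *\<^sub>R 1)" "a $ 1 $ 2 = q" "a $ 2 $ 1 = conjugate q"
    using c(2) by (simp_all add: q_def)
  have two: "(2::2) \<noteq> 1" by simp
  have ex: "\<exists>g. adj g = g \<and> g ** g = mat 1 \<and> g ** a = - (a ** g)"
    if "t * t + r \<bullet> r = 1" "s * t + r \<bullet> q = 0" for t and r :: 'a
  proof -
    define g :: "'a^2^2" where "g = (\<chi> i j. if i = 1 then (if j = 1 then t *\<^sub>R 1 else r)
        else (if j = 1 then conjugate r else - (t *\<^sub>R 1)))"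
    have "r * conjugate q + q * conjugate r = (2 * (r \<bullet> q)) *\<^sub>R 1"
      using add_conjugate[of "r * conjugate q"]
      by (simp add: conjugate_mult real_part_eq_inner inner_mult_one)
    moreover have "conjugate r * q + conjugate q * r = (2 * (r \<bullet> q)) *\<^sub>R 1"
      using add_conjugate[of "conjugate r * q"] inner_conjugate[of r q]
      by (simp add: conjugate_mult real_part_eq_inner inner_mult_one)
    moreover have "r \<bullet> q = - (s * t)" using that(2) by simp
    ultimately have rq: "q * conjugate r = - (2 * (s * t)) *\<^sub>R 1 - r * conjugate q"
      "conjugate q * r = - (2 * (s * t)) *\<^sub>R 1 - conjugate r * q"
      by (simp_all add: algebra_simps)
    have "g ** g = mat 1"
      using that(1) by (simp add: vec_eq_iff forall_2 matrix_matrix_mult_def sum_2 g_def mat_def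
          mult_conjugate_self conjugate_mult_self add.commute flip: scaleR_add_left)
    moreover have "g ** a = - (a ** g)"
      by (simp add: vec_eq_iff forall_2 matrix_matrix_mult_def sum_2 g_def a rq)
        (simp add: algebra_simps flip: scaleR_add_left)
    moreover have "adj g = g"
      by (simp add: vec_eq_iff forall_2 adj_def g_def conjugate_scaleR conjugate_minus)
    ultimately show ?thesis by blast
  qed
  show thesis
  proof (cases "q = 0")
    case True
    then show thesis using ex[of 0 1] that by auto
  next
    case False
    \<comment> \<open>the matrix \<open>(|q|\<^sup>2, -s q; -s q*, -|q|\<^sup>2)\<close> is orthogonal to \<open>a\<close> and has square \<open>n\<close>\<close>
    define n where "n = q \<bullet> q * (q \<bullet> q + s * s)"
    have "q \<bullet> q > 0" using False by simp
    then have n: "n > 0" unfolding n_def by (intro mult_pos_pos add_pos_nonneg) auto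
    have "\<exists>g. adj g = g \<and> g ** g = mat 1 \<and> g ** a = - (a ** g)"
    proof (rule ex[of "(q \<bullet> q) / sqrt n" "(- (s / sqrt n)) *\<^sub>R q"])
      have "(q \<bullet> q) / sqrt n * ((q \<bullet> q) / sqrt n) + ((- (s / sqrt n)) *\<^sub>R q) \<bullet> ((- (s / sqrt n)) *\<^sub>R q)
          = n / (sqrt n * sqrt n)"
        unfolding n_def by (simp add: algebra_simps add_divide_distrib)
      then show "(q \<bullet> q) / sqrt n * ((q \<bullet> q) / sqrt n)
          + ((- (s / sqrt n)) *\<^sub>R q) \<bullet> ((- (s / sqrt n)) *\<^sub>R q) = 1" using n by simp
    qed simp
    then show thesis using that by blast
  qed
qed

text \<open>As \<open>\<xi>\<close> commutes with \<open>A\<close>, it is block diagonal; as it is orthogonal to the identity and to \<open>A\<close>, each of the two blocks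
  has trace zero.\<close>

lemma anticommuting_involution:
  fixes A \<xi> :: "'a::conj_algebra^4^4"
  assumes A: "A \<in> involutions" and \<xi>: "adj \<xi> = \<xi>" "\<xi> \<bullet> mat 1 = 0" "A \<bullet> \<xi> = 0" "A ** \<xi> = \<xi> ** A"
  obtains G where "adj G = G" "G ** G = mat 1" "G ** A = A ** G" "G ** \<xi> = - (\<xi> ** G)"
proof -
  obtain V W :: "'a^2^4" where VW: "adj V ** V = mat 1" "adj W ** W = mat 1" "adj V ** W = 0" "adj W ** V = 0"
    and one: "V ** adj V + W ** adj W = mat 1" and diff: "V ** adj V - W ** adj W = 2 *\<^sub>R A"
    using involution_blocks[OF A] .
  note bl = blocks_mult[OF VW]
  define a where "a = adj V ** \<xi> ** V"
  define b where "b = adj W ** \<xi> ** W"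
  have traces: "\<xi> \<bullet> (V ** adj V) = 0" "\<xi> \<bullet> (W ** adj W) = 0"
  proof -
    have "\<xi> \<bullet> (V ** adj V) + \<xi> \<bullet> (W ** adj W) = 0" "\<xi> \<bullet> (V ** adj V) - \<xi> \<bullet> (W ** adj W) = 0"
      using \<xi> by (simp_all add: one diff inner_commute flip: inner_add_right inner_diff_right)
    then show "\<xi> \<bullet> (V ** adj V) = 0" "\<xi> \<bullet> (W ** adj W) = 0" by linarith+
  qed
  obtain g where g: "adj g = g" "g ** g = mat 1" "g ** a = - (a ** g)"
  proof (rule anticommuting_involution_2x2[of a])
    show "adj a = a" by (simp add: a_def adj_mult \<xi> matrix_mul_assoc)
    have "a \<bullet> mat 1 = \<xi> \<bullet> (V ** adj V)"
      unfolding a_def by (rule inner_compression)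
    then show "a \<bullet> mat 1 = 0" using traces by simp
  qed
  obtain h where h: "adj h = h" "h ** h = mat 1" "h ** b = - (b ** h)"
  proof (rule anticommuting_involution_2x2[of b])
    show "adj b = b" by (simp add: b_def adj_mult \<xi> matrix_mul_assoc)
    have "b \<bullet> mat 1 = \<xi> \<bullet> (W ** adj W)"
      unfolding b_def by (rule inner_compression)
    then show "b \<bullet> mat 1 = 0" using traces by simp
  qed
  have comm: "(V ** adj V - W ** adj W) ** \<xi> - \<xi> ** (V ** adj V - W ** adj W) = 0"
    unfolding diff using \<xi>(4) by (simp add: matrix_mult_scaleR_left matrix_mult_scaleR_right)
  have "adj V ** ((V ** adj V - W ** adj W) ** \<xi> - \<xi> ** (V ** adj V - W ** adj W)) ** W
      = 2 *\<^sub>R (adj V ** \<xi> ** W)"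
    by (simp add: matrix_mult_diff_left matrix_mult_diff_right matrix_mul_assoc[symmetric] VW bl
        matrix_mult_zero_right scaleR_2)
  then have V\<xi>W: "adj V ** \<xi> ** W = 0" by (simp add: comm matrix_mult_zero_left matrix_mult_zero_right)
  have W\<xi>V: "adj W ** \<xi> ** V = 0"
    using arg_cong[OF V\<xi>W, of adj] by (simp add: adj_mult adj_linear \<xi> matrix_mul_assoc)
  have "\<xi> = (V ** adj V + W ** adj W) ** \<xi> ** (V ** adj V + W ** adj W)" by (simp add: one)
  also have "\<dots> = V ** (adj V ** \<xi> ** V) ** adj V + V ** (adj V ** \<xi> ** W) ** adj W
      + (W ** (adj W ** \<xi> ** V) ** adj V + W ** (adj W ** \<xi> ** W) ** adj W)"
    by (simp add: matrix_mult_add_left matrix_mult_add_right matrix_mul_assoc)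
  finally have \<xi>_blocks: "\<xi> = V ** a ** adj V + W ** b ** adj W"
    by (simp add: V\<xi>W W\<xi>V matrix_mult_zero_left matrix_mult_zero_right flip: a_def b_def)
  define G where "G = V ** g ** adj V + W ** h ** adj W"
  have block_mult: "(V ** x ** adj V + W ** y ** adj W) ** (V ** x' ** adj V + W ** y' ** adj W)
      = V ** (x ** x') ** adj V + W ** (y ** y') ** adj W" for x y x' y' :: "'a^2^2"
    by (simp add: matrix_mult_add_left matrix_mult_add_right matrix_mul_assoc[symmetric] bl
        matrix_mult_zero_right)
  show thesis
  proof
    show "adj G = G" by (simp add: G_def adj_linear adj_mult g h matrix_mul_assoc)
    show "G ** G = mat 1" by (simp add: G_def block_mult g h one)
    have "G ** (2 *\<^sub>R A) = (2 *\<^sub>R A) ** G"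
      unfolding diff[symmetric] G_def
      by (simp add: matrix_mult_add_left matrix_mult_add_right matrix_mult_diff_left
          matrix_mult_diff_right matrix_mul_assoc[symmetric] bl matrix_mult_zero_right)
    then show "G ** A = A ** G" by (simp add: matrix_mult_scaleR_left matrix_mult_scaleR_right)
    show "G ** \<xi> = - (\<xi> ** G)"
      unfolding \<xi>_blocks G_def block_mult g(3) h(3)
      by (simp add: matrix_mult_minus_left matrix_mult_minus_right)
  qed
qed


section \<open>Eigenvalues of self-adjoint operators\<close>

text \<open>A maximiser of the quadratic form \<open>f x \<bullet> x\<close> on the unit sphere of \<open>S\<close> is an eigenvector.\<close>

lemma selfadjoint_eigenvector:
  fixes f :: "'a::euclidean_space \<Rightarrow> 'a"
  assumes f: "linear f" and S: "subspace S" "S \<noteq> {0}" and inv: "\<And>x. x \<in> S \<Longrightarrow> f x \<in> S"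
    and sa: "\<And>x y. x \<in> S \<Longrightarrow> y \<in> S \<Longrightarrow> f x \<bullet> y = x \<bullet> f y"
  obtains u \<mu> where "u \<in> S" "norm u = 1" "f u = \<mu> *\<^sub>R u"
proof -
  let ?K = "S \<inter> sphere 0 1"
  have K: "compact ?K" using closed_subspace[OF S(1)] by (simp add: closed_Int_compact)
  obtain x where "x \<in> S" "x \<noteq> 0" using S subspace_0 by blast
  then have "(1 / norm x) *\<^sub>R x \<in> ?K" using S(1) by (simp add: subspace_scale)
  then have ne: "?K \<noteq> {}" by blast
  have cont: "continuous_on ?K (\<lambda>x. f x \<bullet> x)"
    using f by (intro continuous_intros linear_continuous_on) (simp add: linear_conv_bounded_linear)
  obtain u where u: "u \<in> ?K" and max: "\<And>y. y \<in> ?K \<Longrightarrow> f y \<bullet> y \<le> f u \<bullet> u"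
    using continuous_attains_sup[OF K ne cont] by auto
  define \<mu> where "\<mu> = f u \<bullet> u"
  have uS: "u \<in> S" and uu: "u \<bullet> u = 1" using u by (auto simp: norm_eq_1)
  have le: "f y \<bullet> y \<le> \<mu> * (y \<bullet> y)" if "y \<in> S" for y
  proof (cases "y = 0")
    case False
    then have "(1 / norm y) *\<^sub>R y \<in> ?K" using S(1) that by (simp add: subspace_scale)
    from max[OF this] have "(f y \<bullet> y) / (norm y * norm y) \<le> \<mu>"
      by (simp add: \<mu>_def linear_scale[OF f])
    then show ?thesis using False by (simp add: divide_le_eq dot_square_norm power2_eq_square)
  qed (simp add: linear_0[OF f])
  define w where "w = f u - \<mu> *\<^sub>R u"
  have wS: "w \<in> S" using S(1) uS inv by (simp add: w_def subspace_diff subspace_scale)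
  have wu: "w \<bullet> u = 0" by (simp add: w_def inner_diff_left \<mu>_def uu)
  have fuw: "f u \<bullet> w = w \<bullet> w" using wu by (simp add: w_def inner_diff_left inner_commute)
  define c where "c = \<mu> * (w \<bullet> w) - f w \<bullet> w"
  \<comment> \<open>Moving the maximiser by \<open>t w\<close> raises the quadratic form by \<open>2 t |w|\<^sup>2\<close> to first order, so \<open>w\<close> must vanish.\<close>
  have quad: "2 * t * (w \<bullet> w) \<le> t * t * c" for t
  proof -
    have "u + t *\<^sub>R w \<in> S" using S(1) uS wS by (simp add: subspace_add subspace_scale)
    note le[OF this]
    moreover have "f (u + t *\<^sub>R w) \<bullet> (u + t *\<^sub>R w) = \<mu> + 2 * t * (w \<bullet> w) + t * t * (f w \<bullet> w)"
      using sa[OF wS uS] fuw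
      by (simp add: linear_add[OF f] linear_scale[OF f] inner_add_left inner_add_right \<mu>_def
          inner_commute algebra_simps)
    moreover have "(u + t *\<^sub>R w) \<bullet> (u + t *\<^sub>R w) = 1 + t * t * (w \<bullet> w)"
      using wu by (simp add: inner_add_left inner_add_right uu inner_commute algebra_simps)
    ultimately have "\<mu> + 2 * t * (w \<bullet> w) + t * t * (f w \<bullet> w) \<le> \<mu> * (1 + t * t * (w \<bullet> w))"
      by (simp only:)
    then show ?thesis by (simp add: c_def algebra_simps)
  qed
  have "w \<bullet> w = 0"
  proof (rule ccontr)
    assume "w \<bullet> w \<noteq> 0"
    then have pos: "w \<bullet> w > 0" using inner_ge_zero[of w] by linarith
    define t where "t = (w \<bullet> w) / (\<bar>c\<bar> + 1)"
    have t: "t > 0" using pos by (simp add: t_def)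
    have "t * (2 * (w \<bullet> w)) \<le> t * (t * c)" using quad[of t] by (simp add: mult_ac)
    then have "2 * (w \<bullet> w) \<le> t * c" using t by (simp add: mult_le_cancel_left)
    also have "\<dots> \<le> t * (\<bar>c\<bar> + 1)" using t by (intro mult_left_mono) auto
    also have "\<dots> = w \<bullet> w" by (simp add: t_def)
    finally show False using pos by simp
  qed
  then have "f u = \<mu> *\<^sub>R u" by (simp add: w_def)
  with that u show thesis by auto
qed

lemma selfadjoint_eigenbasis:
  fixes f :: "'a::euclidean_space \<Rightarrow> 'a"
  assumes f: "linear f" and "subspace S" "\<And>x. x \<in> S \<Longrightarrow> f x \<in> S"
    and "\<And>x y. x \<in> S \<Longrightarrow> y \<in> S \<Longrightarrow> f x \<bullet> y = x \<bullet> f y"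
  shows "\<exists>B. pairwise orthogonal B \<and> (\<forall>b\<in>B. norm b = 1 \<and> (\<exists>\<mu>. f b = \<mu> *\<^sub>R b)) \<and> span B = S"
  using assms(2-4)
proof (induction "dim S" arbitrary: S rule: less_induct)
  case less
  show ?case
  proof (cases "S = {0}")
    case True
    then show ?thesis by (intro exI[of _ "{}"]) simp
  next
    case False
    obtain u \<mu> where u: "u \<in> S" "norm u = 1" "f u = \<mu> *\<^sub>R u"
      using selfadjoint_eigenvector[OF f less.prems(1) False less.prems(2,3)] by metis
    let ?S' = "{y \<in> S. u \<bullet> y = 0}"
    have "dim ?S' + 1 = dim S"
      using u by (intro dim_orthogonal_in_subspace less.prems) auto
    moreover have sub: "subspace ?S'"
      using less.prems(1) by (auto simp: subspace_def inner_add_right)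
    moreover have "f y \<in> ?S'" if "y \<in> ?S'" for y
      using that less.prems(3)[OF u(1), of y] less.prems(2) u(3) by simp
    ultimately obtain B where B: "pairwise orthogonal B"
      "\<forall>b\<in>B. norm b = 1 \<and> (\<exists>\<mu>. f b = \<mu> *\<^sub>R b)" "span B = ?S'"
      using less.hyps[of ?S'] less.prems(3) by (metis (no_types, lifting) less_add_one mem_Collect_eq)
    have BS: "b \<in> S \<and> u \<bullet> b = 0" if "b \<in> B" for b using span_base[OF that] B(3) by simp
    have "pairwise orthogonal (insert u B)"
      using B(1) BS by (auto simp: pairwise_insert orthogonal_def inner_commute)
    moreover have "span (insert u B) = S"
    proof (intro equalityI subsetI)
      fix x assume "x \<in> span (insert u B)"
      then show "x \<in> S"
        using span_minimal[of "insert u B" S] less.prems(1) u(1) BS by auto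
    next
      fix x assume "x \<in> S"
      then have "x - (u \<bullet> x) *\<^sub>R u \<in> ?S'"
        using u less.prems(1) by (simp add: subspace_diff subspace_scale inner_diff_right dot_square_norm)
      then show "x \<in> span (insert u B)"
        unfolding B(3)[symmetric] span_insert by blast
    qed
    ultimately show ?thesis using B(2) u by (intro exI[of _ "insert u B"]) auto
  qed
qed

text \<open>In an orthonormal eigenbasis, an eigenvector for \<open>\<mu>\<close> is orthogonal to the basis vectors with other eigenvalues, so each eigenspace is
  spanned by the basis vectors that it contains.\<close>

lemma selfadjoint_eigenvalue_list:
  fixes f :: "'a::euclidean_space \<Rightarrow> 'a"
  assumes f: "linear f" "subspace S" "\<And>x. x \<in> S \<Longrightarrow> f x \<in> S"
    and sa: "\<And>x y. x \<in> S \<Longrightarrow> y \<in> S \<Longrightarrow> f x \<bullet> y = x \<bullet> f y"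
  shows "\<exists>\<kappa>s. length \<kappa>s = dim S \<and> (\<forall>\<mu>. count_list \<kappa>s \<mu> = dim {x \<in> S. f x = \<mu> *\<^sub>R x})"
proof -
  obtain B where orth: "pairwise orthogonal B"
    and B: "\<And>b. b \<in> B \<Longrightarrow> norm b = 1" "\<And>b. b \<in> B \<Longrightarrow> \<exists>\<mu>. f b = \<mu> *\<^sub>R b" and span: "span B = S"
    using selfadjoint_eigenbasis[OF assms] by metis
  have BS: "b \<in> S" if "b \<in> B" for b using span_base[OF that] span by simp
  have ind: "independent B"
    using orth B(1) by (intro pairwise_orthogonal_independent) fastforce+
  then have fin: "finite B" by (rule independent_imp_finite)
  obtain ev where ev: "\<And>b. b \<in> B \<Longrightarrow> f b = ev b *\<^sub>R b" using B(2) by metis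
  obtain bs where bs: "set bs = B" "distinct bs" using finite_distinct_list[OF fin] by blast
  show ?thesis
  proof (intro exI[of _ "map ev bs"] conjI allI)
    show "length (map ev bs) = dim S"
      using bs ind span by (simp add: distinct_card[symmetric] dim_span_eq_card_independent[symmetric])
    fix \<mu>
    let ?B = "{b \<in> B. ev b = \<mu>}"
    have "{x \<in> S. f x = \<mu> *\<^sub>R x} = span ?B"
    proof (intro equalityI subsetI)
      fix x assume "x \<in> span ?B"
      moreover have "subspace {x \<in> S. f x = \<mu> *\<^sub>R x}"
        using f by (auto simp: subspace_def linear_0 linear_add linear_scale scaleR_add_right)
      ultimately show "x \<in> {x \<in> S. f x = \<mu> *\<^sub>R x}"
        using span_minimal[of ?B "{x \<in> S. f x = \<mu> *\<^sub>R x}"] ev BS by auto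
    next
      fix x assume x: "x \<in> {x \<in> S. f x = \<mu> *\<^sub>R x}"
      have "(x \<bullet> b) *\<^sub>R b \<in> span ?B" if "b \<in> B" for b
      proof (cases "ev b = \<mu>")
        case True
        then show ?thesis using that by (intro span_scale span_base) simp
      next
        case False
        have "\<mu> * (x \<bullet> b) = ev b * (x \<bullet> b)"
          using sa[of x b] x BS[OF that] ev[OF that] by simp
        then show ?thesis using False by (simp add: span_zero)
      qed
      then have "(\<Sum>b\<in>B. (x \<bullet> b) *\<^sub>R b) \<in> span ?B" by (intro span_sum)
      then show "x \<in> span ?B"
        using orthonormal_basis_expand[OF orth B(1) _ fin, of x] x span by simp
    qed
    moreover have "dim (span ?B) = card ?B"
      using ind by (simp add: dim_eq_card_independent independent_mono)
    moreover have "count_list (map ev bs) \<mu> = card ?B"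
    proof -
      have "count_list (map ev bs) \<mu> = length (filter (\<lambda>b. ev b = \<mu>) bs)"
        by (induction bs) auto
      also have "\<dots> = card (set (filter (\<lambda>b. ev b = \<mu>) bs))"
        using bs(2) by (intro distinct_card[symmetric] distinct_filter)
      finally show ?thesis by (simp add: bs(1))
    qed
    ultimately show "count_list (map ev bs) \<mu> = dim {x \<in> S. f x = \<mu> *\<^sub>R x}" by simp
  qed
qed


section \<open>Odd symmetric polynomials\<close>

text \<open>On a list that is symmetric about \<open>0\<close>, negation of the entries agrees with some permutation \<open>\<pi>\<close> of the variables.
  Symmetric polynomials are invariant under \<open>\<pi>\<close>, while those of odd degree change sign under negation.\<close>

lemma odd_symmetric_vanish_if_symmetric_counts:
  assumes sym: "\<And>\<mu>. count_list \<kappa>s (- \<mu>) = count_list \<kappa>s \<mu>"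
  shows "odd_symmetric_vanish \<kappa>s"
proof -
  let ?n = "length \<kappa>s"
  have "count_list (map uminus \<kappa>s) \<mu> = count_list \<kappa>s (- \<mu>)" for \<mu> :: real
    by (induction \<kappa>s) (auto simp: minus_equation_iff)
  then have "mset (map uminus \<kappa>s) = mset \<kappa>s"
    by (intro multiset_eqI) (simp add: count_mset sym del: mset_map)
  then obtain \<pi> where \<pi>: "\<pi> permutes {..<?n}" "permute_list \<pi> \<kappa>s = map uminus \<kappa>s"
    using mset_eq_permutation by metis
  have neg: "\<kappa>s ! (\<pi> i) = - (\<kappa>s ! i)" if "i < ?n" for i
    using arg_cong[OF \<pi>(2), of "\<lambda>l. l ! i"] that by (simp add: permute_list_nth \<pi>(1))
  show ?thesis
    unfolding odd_symmetric_vanish_def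
  proof (intro allI impI)
    fix k c assume k: "odd k" and c: "symmetric_coeffs ?n k c"
    let ?E = "exponents ?n k"
    define g where "g \<alpha> = c \<alpha> * (\<Prod>i<?n. \<kappa>s ! i ^ \<alpha> i)" for \<alpha>
    have in_E: "\<alpha> \<circ> \<rho> \<in> ?E" if "\<rho> permutes {..<?n}" "\<alpha> \<in> ?E" for \<rho> \<alpha>
      using that permutes_not_in[OF that(1)] sum.permute[OF that(1), of \<alpha>] by (simp add: exponents_def)
    have "bij_betw (\<lambda>\<alpha>. \<alpha> \<circ> \<pi>) ?E ?E"
    proof (rule bij_betw_byWitness[where f' = "\<lambda>\<alpha>. \<alpha> \<circ> inv \<pi>"])
      show "(\<lambda>\<alpha>. \<alpha> \<circ> \<pi>) ` ?E \<subseteq> ?E" "(\<lambda>\<alpha>. \<alpha> \<circ> inv \<pi>) ` ?E \<subseteq> ?E"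
        using in_E \<pi>(1) permutes_inv[OF \<pi>(1)] by blast+
    qed (simp_all add: comp_assoc permutes_inv_o[OF \<pi>(1)])
    then have "sum g ?E = (\<Sum>\<alpha>\<in>?E. g (\<alpha> \<circ> \<pi>))"
      by (rule sum.reindex_bij_betw[symmetric])
    also have "\<dots> = (\<Sum>\<alpha>\<in>?E. - g \<alpha>)"
    proof (rule sum.cong[OF refl])
      fix \<alpha> assume \<alpha>: "\<alpha> \<in> ?E"
      then have \<alpha>': "\<alpha> \<circ> \<pi> \<in> ?E" using in_E \<pi>(1) by blast
      have "(\<Prod>i<?n. \<kappa>s ! i ^ \<alpha> i) = (\<Prod>i<?n. \<kappa>s ! (\<pi> i) ^ \<alpha> (\<pi> i))"
        using prod.permute[OF \<pi>(1), of "\<lambda>i. \<kappa>s ! i ^ \<alpha> i"] by (simp add: o_def)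
      also have "\<dots> = (\<Prod>i<?n. (-1) ^ (\<alpha> \<circ> \<pi>) i * \<kappa>s ! i ^ (\<alpha> \<circ> \<pi>) i)"
        by (rule prod.cong) (simp_all add: neg power_minus[of "\<kappa>s ! _"])
      also have "\<dots> = (-1) ^ (\<Sum>i<?n. (\<alpha> \<circ> \<pi>) i) * (\<Prod>i<?n. \<kappa>s ! i ^ (\<alpha> \<circ> \<pi>) i)"
        by (simp add: prod.distrib power_sum)
      also have "(\<Sum>i<?n. (\<alpha> \<circ> \<pi>) i) = k" using \<alpha>' by (simp add: exponents_def)
      finally have "(\<Prod>i<?n. \<kappa>s ! i ^ \<alpha> i) = - (\<Prod>i<?n. \<kappa>s ! i ^ (\<alpha> \<circ> \<pi>) i)" using k by simp
      moreover have "c (\<alpha> \<circ> \<pi>) = c \<alpha>" using c \<pi>(1) \<alpha> by (simp add: symmetric_coeffs_def)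
      ultimately show "g (\<alpha> \<circ> \<pi>) = - g \<alpha>" unfolding g_def by simp
    qed
    also have "\<dots> = - sum g ?E" by (rule sum_negf)
    finally show "eval_homogeneous ?n k c ((!) \<kappa>s) = 0"
      by (simp add: eval_homogeneous_def g_def)
  qed
qed


section \<open>Austerity\<close>

text \<open>With \<open>N = A \<xi>\<close>, the shape operator is \<open>s X = - 2 (N X + X N)\<close>. The involution \<open>G\<close> anticommutes with \<open>N\<close>, so
  \<open>X \<mapsto> G X G\<close> maps the eigenspace of \<open>s\<close> for \<open>\<mu>\<close> injectively into the one for \<open>-\<mu>\<close>.\<close>

lemma austere_submanifold_crit_set:
  "austere_submanifold (4 * DIM('a)) (crit_set :: ('a::conj_algebra^4^4) set) herm_sphere"
  unfolding austere_submanifold_def crit_set_eq_involutions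
proof (intro conjI ballI)
  show "submanifold_of (4 * DIM('a)) (involutions :: ('a^4^4) set) herm_sphere"
    unfolding submanifold_of_def
  proof (intro conjI exI)
    show "smooth_submanifold (dim (herm0 :: ('a^4^4) set) - 1) (herm_sphere :: ('a^4^4) set)"
      unfolding herm_sphere_eq by (rule smooth_submanifold_unit_sphere[OF subspace_herm0])
    show "smooth_submanifold (4 * DIM('a)) (involutions :: ('a^4^4) set)"
      by (rule smooth_submanifold_involutions) (rule dim_anticommutant)
    show "involutions \<subseteq> (herm_sphere :: ('a^4^4) set)"
      using crit_set_eq_involutions by (auto simp: crit_set_def)
  qed
next
  fix A \<xi> :: "'a^4^4"
  assume A: "A \<in> involutions" and \<xi>N: "\<xi> \<in> normal_space herm_sphere involutions A"
  let ?T = "anticommutant A"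
  have \<xi>: "adj \<xi> = \<xi>" "\<xi> \<bullet> mat 1 = 0" "A \<bullet> \<xi> = 0" "A ** \<xi> = \<xi> ** A"
    using \<xi>N by (auto simp: normal_space_involutions[OF A] mem_herm0_iff)
  define N where "N = A ** \<xi>"
  have N: "adj N = N" "A ** N = N ** A"
    using \<xi> by (simp_all add: N_def adj_mult involutionsD(2)[OF A] matrix_mul_assoc)
  define s where "s X = - (2 *\<^sub>R (N ** X + X ** N))" for X
  have shape: "shape_operator herm_sphere involutions A \<xi> X = s X" if "X \<in> ?T" for X
    using shape_operator_involutions[OF A \<xi>N that] by (simp add: s_def N_def matrix_mul_assoc)
  have lin: "linear s"
    by (rule linearI) (simp_all add: s_def matrix_algebra algebra_simps)
  have s_T: "s X \<in> ?T" if X: "X \<in> ?T" for X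
  proof -
    have "A ** (N ** X + X ** N) = - ((N ** X + X ** N) ** A)"
    proof -
      have AX: "A ** X = - (X ** A)" using mem_anticommutantD(2)[OF X] by simp
      have "A ** (N ** X) = N ** (A ** X)" by (simp add: matrix_mul_assoc N(2))
      then have "A ** (N ** X) = - (N ** X ** A)" by (simp add: AX matrix_mult_minus_right matrix_mul_assoc)
      moreover have "A ** (X ** N) = - (X ** (A ** N))"
        by (simp add: matrix_mul_assoc AX matrix_mult_minus_left)
      then have "A ** (X ** N) = - (X ** N ** A)" by (simp add: N(2) matrix_mul_assoc)
      ultimately show ?thesis by (simp add: matrix_mult_add_left matrix_mult_add_right)
    qed
    then have "N ** X + X ** N \<in> ?T"
      by (simp add: anticommutant_def adj_linear adj_mult N mem_anticommutantD(1)[OF X] add.commute)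
    then have "(- 2) *\<^sub>R (N ** X + X ** N) \<in> ?T" by (rule subspace_scale[OF subspace_anticommutant])
    then show ?thesis by (simp add: s_def)
  qed
  have sa: "s X \<bullet> Y = X \<bullet> s Y" for X Y
  proof -
    have "(N ** X) \<bullet> Y = X \<bullet> (N ** Y)" "(X ** N) \<bullet> Y = X \<bullet> (Y ** N)"
      by (simp_all only: matrix_inner_left_adjoint[of N X] matrix_inner_right_adjoint[of X N] N(1))
    then show ?thesis by (simp add: s_def inner_add_left inner_add_right)
  qed
  obtain \<kappa>s where \<kappa>s: "length \<kappa>s = dim ?T" "\<And>\<mu>. count_list \<kappa>s \<mu> = dim {X \<in> ?T. s X = \<mu> *\<^sub>R X}"
    using selfadjoint_eigenvalue_list[OF lin subspace_anticommutant[of A] s_T sa] by blast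
  obtain G where G: "adj G = G" "G ** G = mat 1" "G ** A = A ** G" "G ** \<xi> = - (\<xi> ** G)"
    using anticommuting_involution[OF A \<xi>] .
  have GN: "G ** N = - (N ** G)"
    unfolding N_def matrix_mul_assoc G(3)
    by (simp add: G(4) matrix_mult_minus_right flip: matrix_mul_assoc)
  define F where "F X = G ** X ** G" for X
  have FF: "F (F X) = X" for X
  proof -
    have "F (F X) = (G ** G) ** X ** (G ** G)" by (simp add: F_def matrix_mul_assoc)
    then show ?thesis by (simp add: G)
  qed
  have linF: "linear F"
    by (rule linearI) (simp_all add: F_def matrix_mult_add_left matrix_mult_add_right
        matrix_mult_scaleR_left matrix_mult_scaleR_right)
  have F_T: "F X \<in> ?T" if X: "X \<in> ?T" for X
  proof -
    have "A ** F X = G ** (A ** X) ** G"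
      by (simp add: F_def matrix_mul_assoc G(3))
    moreover have "F X ** A = G ** X ** (G ** A)" by (simp add: F_def matrix_mul_assoc)
    then have "F X ** A = G ** (X ** A) ** G" by (simp only: G(3) matrix_mul_assoc)
    ultimately have "A ** F X + F X ** A = G ** (A ** X + X ** A) ** G"
      by (simp add: matrix_mult_add_left matrix_mult_add_right)
    also have "\<dots> = 0" using X by (simp add: anticommutant_def matrix_mult_zero_left matrix_mult_zero_right)
    finally show ?thesis
      using mem_anticommutantD(1)[OF X] by (simp add: anticommutant_def F_def adj_mult G matrix_mul_assoc)
  qed
  have sF: "s (F X) = - F (s X)" for X
  proof -
    have NG: "N ** G = - (G ** N)" using GN by simp
    have "N ** F X = (N ** G) ** X ** G" by (simp add: F_def matrix_mul_assoc)
    then have "N ** F X = - (G ** (N ** X) ** G)"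
      by (simp only: NG matrix_mult_minus_left matrix_mul_assoc)
    moreover have "F X ** N = G ** X ** (G ** N)" by (simp add: F_def matrix_mul_assoc)
    then have "F X ** N = - (G ** (X ** N) ** G)"
      by (simp only: GN matrix_mult_minus_right matrix_mul_assoc)
    ultimately have "N ** F X + F X ** N = - F (N ** X + X ** N)"
      by (simp add: F_def matrix_mult_add_left matrix_mult_add_right)
    then show ?thesis
      by (simp add: s_def linear_neg[OF linF] linear_scale[OF linF])
  qed
  have le: "dim {X \<in> ?T. s X = \<mu> *\<^sub>R X} \<le> dim {X \<in> ?T. s X = (- \<mu>) *\<^sub>R X}" for \<mu>
  proof -
    let ?E = "{X \<in> ?T. s X = \<mu> *\<^sub>R X}"
    have "inj F" using FF by (metis injI)
    then have "dim ?E = dim (F ` ?E)" by (intro dim_image_eq[OF linF, symmetric]) (blast intro: inj_on_subset)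
    also have "F ` ?E \<subseteq> {X \<in> ?T. s X = (- \<mu>) *\<^sub>R X}"
      using F_T sF by (auto simp: linear_scale[OF linF])
    then have "dim (F ` ?E) \<le> dim {X \<in> ?T. s X = (- \<mu>) *\<^sub>R X}" by (rule dim_subset)
    finally show ?thesis .
  qed
  have "count_list \<kappa>s (- \<mu>) = count_list \<kappa>s \<mu>" for \<mu>
    using le[of \<mu>] le[of "- \<mu>"] by (simp add: \<kappa>s(2))
  then have "odd_symmetric_vanish \<kappa>s" by (rule odd_symmetric_vanish_if_symmetric_counts)
  moreover have "{X \<in> ?T. shape_operator herm_sphere involutions A \<xi> X = \<mu> *\<^sub>R X} = {X \<in> ?T. s X = \<mu> *\<^sub>R X}" for \<mu>
    using shape by auto
  then have "principal_curvatures herm_sphere involutions A \<xi> \<kappa>s"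
    by (simp add: principal_curvatures_def tangent_space_involutions[OF A] \<kappa>s)
  ultimately show "\<exists>\<kappa>s. principal_curvatures herm_sphere involutions A \<xi> \<kappa>s \<and> odd_symmetric_vanish \<kappa>s"
    by blast
qed

theorem proposition5p1:
  shows "austere_submanifold (4 * DIM(real)) (crit_set :: (real^4^4) set) herm_sphere \<and>
         austere_submanifold (4 * DIM(complex)) (crit_set :: (complex^4^4) set) herm_sphere \<and>
         austere_submanifold (4 * DIM(quat)) (crit_set :: (quat^4^4) set) herm_sphere"
  by (intro conjI austere_submanifold_crit_set)

end
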